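(* Let $\alpha>0$ be not an even integer. Then $H_\alpha$ (interpreted as its extension into the complex domain) is an entire function of exponential type $1$, interpolating $|x|^\alpha$ at the points $\{k\pi:k=0,1,2,\dots\}$, and $H_\alpha$ admits a representation as an interpolating series of the following form. Let $N=[\alpha/2]$. Then, for all $x\in\mathbb{R}$, $$H_\alpha(x)=\sin x\left(\frac{2}{\pi}\sum_{n=0}^{N-1}\sin\left(\frac{\pi(\alpha-2n-2)}{2}\right)C(\alpha-2n-2)\,x^{2n+1}+2x^{2N+1}\sum_{k=1}^\infty(-1)^k\frac{(k\pi)^{\alpha-2N}}{x^2-(k\pi)^2}\right).$$ For the special case $0<\alpha<2$ the expansion is $$H_\alpha(x)=2x\sin x\sum_{k=1}^\infty(-1)^k\frac{(k\pi)^\alpha}{x^2-(k\pi)^2}.$$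
   Context: For $\alpha>0$, $x>0$, $H(\alpha,x)=\int_0^\infty \frac{t^\alpha}{\sinh t}\frac{x\sin x}{x^2+t^2}\,dt$, and $H(\alpha,0)=0$ (its limit as $x\to0^+$). For $x\ge0$, $H_\alpha(x)=|x|^\alpha-\frac{2}{\pi}\sin\frac{\pi\alpha}{2}\,H(\alpha,x)$; the theorem concerns the extension of this function from $[0,\infty)$ to $\mathbb{C}$. $C(\alpha)=\int_0^\infty\frac{t^\alpha}{\sinh t}\,dt$ for $\alpha>0$. $[x]$ is the floor of $x$; an empty sum is $0$. An entire function $f$ is of exponential type $A\ge0$ if $A$ is the infimum of all numbers $A'\geq 0$ such that for each $\varepsilon>0$ there is $z_0=z_0(\varepsilon)$ with $|f(z)|\le\exp(|z|(A'+\varepsilon))$ for all $z\in\mathbb{C}$ with $|z|\ge|z_0|$. At the points $x=\pm k\pi$, $k\ge1$, the right-hand sides of the series formulas are understood by continuity (the simple poles of the series are cancelled by the zeros of $\sin x$). *)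

theory Defs
  imports "HOL-Complex_Analysis.Complex_Analysis"
begin

definition H_int :: "real \<Rightarrow> real \<Rightarrow> real" where
  "H_int \<alpha> x =
     (if x = 0 then 0
      else set_lebesgue_integral lborel {0<..}
             (\<lambda>t. t powr \<alpha> / sinh t * (x * sin x / (x\<^sup>2 + t\<^sup>2))))"

text \<open>Only meant for nonnegative arguments; on the negative half-line the function of
  interest is the entire extension of this one from the half-line of nonnegative reals.\<close>

definition H_fun :: "real \<Rightarrow> real \<Rightarrow> real" where
  "H_fun \<alpha> x = \<bar>x\<bar> powr \<alpha> - 2 / pi * sin (pi * \<alpha> / 2) * H_int \<alpha> x"

definition C_const :: "real \<Rightarrow> real" where
  "C_const \<alpha> = set_lebesgue_integral lborel {0<..} (\<lambda>t. t powr \<alpha> / sinh t)"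

definition exp_type_bounds :: "(complex \<Rightarrow> complex) \<Rightarrow> real set" where
  "exp_type_bounds f =
     {A'. 0 \<le> A' \<and>
          (\<forall>\<epsilon>>0. \<exists>z0::complex. \<forall>z. norm z \<ge> norm z0 \<longrightarrow>
             norm (f z) \<le> exp (norm z * (A' + \<epsilon>)))}"

text \<open>Nonemptiness is required since the infimum of the empty set of reals is not meaningful.\<close>

definition entire_of_exp_type :: "(complex \<Rightarrow> complex) \<Rightarrow> real \<Rightarrow> bool" where
  "entire_of_exp_type f A \<longleftrightarrow>
     f holomorphic_on UNIV \<and> exp_type_bounds f \<noteq> {} \<and> A = Inf (exp_type_bounds f)"

definition poles :: "real set" where
  "poles = {x. \<exists>k::nat. 1 \<le> k \<and> (x = real k * pi \<or> x = - (real k * pi))}"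

definition series_term :: "real \<Rightarrow> real \<Rightarrow> nat \<Rightarrow> real" where
  "series_term \<beta> x k = (-1) ^ k * ((real k * pi) powr \<beta> / (x\<^sup>2 - (real k * pi)\<^sup>2))"

text \<open>The series runs over the indices from 1 on. It need not converge absolutely, so it is
  an ordinary (ordered) infinite series.\<close>

definition pole_series :: "real \<Rightarrow> real \<Rightarrow> real" where
  "pole_series \<beta> x = (\<Sum>j. series_term \<beta> x (Suc j))"

text \<open>Validity on the whole real line of an expansion of \<open>F\<close> whose right-hand side \<open>R\<close> is
  literally defined off the poles and is understood by continuity at the poles.\<close>

definition expands_on_reals :: "(complex \<Rightarrow> complex) \<Rightarrow> (real \<Rightarrow> real) \<Rightarrow> bool" where
  "expands_on_reals F R \<longleftrightarrow>
     (\<forall>x. x \<notin> poles \<longrightarrow> F (of_real x) = of_real (R x)) \<and>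
     (\<forall>x\<in>poles. ((\<lambda>y. complex_of_real (R y)) \<longlongrightarrow> F (of_real x)) (at x))"

end

theory Submission
  imports Defs "HOL-Real_Asymp.Real_Asymp"
begin

text \<open>
  Put \<open>\<beta> = \<alpha> - 2N\<close>, so that \<open>0 < \<beta> < 2\<close>. Inserting the partial fractions of \<open>1 / sinh t\<close> into the integral
  for \<open>H(\<beta>, x)\<close> and integrating term by term with \<open>\<integral> t\<^bsup>s-1\<^esup> / (t\<^sup>2 + a\<^sup>2) dt\<close> produces the pole series,
  while the partial fractions of \<open>1 / sin x\<close> absorb the term \<open>x\<^sup>\<beta>\<close>. The identity
  \<open>t\<^sup>2 / (x\<^sup>2 + t\<^sup>2) = 1 - x\<^sup>2 / (x\<^sup>2 + t\<^sup>2)\<close> lowers \<open>\<alpha>\<close> by two and yields the polynomial part.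

  Multiplied by \<open>sin z\<close>, the pole series becomes, up to a multiple of \<open>sin z\<close>, an absolutely convergent
  series of functions \<open>sinc (z - k\<pi>) - sinc (z + k\<pi>)\<close>; as \<open>\<bar>sinc z\<bar> \<le> exp \<bar>Im z\<bar>\<close>, this gives the entire
  extension and the bound 1 on its type. On the right half-plane the extension agrees with its integral
  representation, where \<open>1 / (z\<^sup>2 + t\<^sup>2)\<close> is holomorphic in \<open>z\<close>; on rays close to the imaginary axis that
  representation shows growth like \<open>sin z / z\<close>, so that the type cannot be less than 1.
\<close>

section \<open>Partial fractions of the cosecant\<close>

lemma sin_pi_times_nonzero:
  fixes z :: complex
  assumes "z \<notin> \<int>"
  shows "sin (of_real pi * z) \<noteq> 0"
proof
  assume "sin (of_real pi * z) = 0"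
  then obtain n :: int where "of_real pi * z = of_real (of_int n * pi)"
    by (auto simp: sin_eq_0)
  then have "z = of_int n" by simp
  with assms show False by simp
qed

text \<open>Logarithmic derivative of the reflection formula. It is stated with
  \<open>rGamma\<close>, whose derivative is \<open>- rGamma z * Digamma z\<close>; dividing by the
  product \<open>sin (of_real pi * z) / of_real pi\<close> leaves the cotangent.\<close>

lemma Digamma_reflection:
  fixes z :: complex
  assumes "z \<notin> \<int>"
  shows "Digamma (1 - z) - Digamma z = of_real pi * cot (of_real pi * z)"
proof -
  have s: "sin (of_real pi * z) \<noteq> 0"
    using assms by (rule sin_pi_times_nonzero)
  have [simp]: "z \<notin> \<int>\<^sub>\<le>\<^sub>0" "1 - z \<notin> \<int>\<^sub>\<le>\<^sub>0"
    using assms nonpos_Ints_Int[of z] nonpos_Ints_Int[of "1 - z"]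
    by (auto simp: Ints_diff minus_in_Ints_iff dest: Ints_diff[of 1 "1 - z"])
  have eq: "(\<lambda>z::complex. rGamma z * rGamma (1 - z)) = (\<lambda>z. sin (of_real pi * z) / of_real pi)"
    by (rule ext) (rule rGamma_reflection_complex)
  have "((\<lambda>z. rGamma z * rGamma (1 - z)) has_field_derivative
          (rGamma z * rGamma (1 - z) * (Digamma (1 - z) - Digamma z))) (at z)"
    by (auto intro!: derivative_eq_intros has_field_derivative_rGamma_no_nonpos_int simp: algebra_simps)
  moreover have "((\<lambda>z. sin (of_real pi * z) / of_real pi) has_field_derivative cos (of_real pi * z)) (at z)"
    by (auto intro!: derivative_eq_intros)
  ultimately have "rGamma z * rGamma (1 - z) * (Digamma (1 - z) - Digamma z) = cos (of_real pi * z)"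
    unfolding eq by (rule DERIV_unique)
  with s show ?thesis
    by (simp add: rGamma_reflection_complex cot_def field_simps)
qed

text \<open>Each Digamma value is the limit of a logarithm minus a sum of reciprocals; the
  logarithms cancel in the difference of the values at \<open>1 - z\<close> and
  \<open>z\<close>.\<close>

lemma cot_partial_sums:
  fixes z :: complex
  assumes "z \<notin> \<int>"
  shows "(\<lambda>m. \<Sum>n<m. 1 / (z + of_nat n) - 1 / (of_nat n + 1 - z))
           \<longlonglongrightarrow> of_real pi * cot (of_real pi * z)"
proof -
  have "z \<noteq> 0" "1 - z \<noteq> 0" using assms by auto
  from tendsto_diff[OF Digamma_LIMSEQ[OF this(2)] Digamma_LIMSEQ[OF this(1)]]
  show ?thesis
    by (simp add: Digamma_reflection[OF assms] sum_subtractf inverse_eq_divide algebra_simps)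
qed

lemma csc_eq_cot_diff:
  fixes z :: complex
  assumes "sin (2 * z) \<noteq> 0"
  shows "1 / sin (2 * z) = cot z - cot (2 * z)"
proof -
  have [simp]: "sin z \<noteq> 0" "cos z \<noteq> 0" using assms by (auto simp: sin_double)
  show ?thesis
    unfolding cot_def sin_double cos_double_cos by (simp add: field_simps power2_eq_square)
qed

text \<open>The cosecant is a difference of cotangents at half and full argument. Since
  \<open>1 / (z/2 + m) = 2 / (z + 2 * m)\<close>, subtracting \<open>2 * m\<close> terms of the
  second expansion from \<open>m\<close> terms of the first makes the signs alternate.\<close>

lemma csc_partial_sums:
  fixes z :: complex
  assumes "z \<notin> \<int>"
  shows "(\<lambda>m. \<Sum>n<2*m. (-1)^n * (1 / (z + of_nat n) + 1 / (of_nat n + 1 - z)))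
           \<longlonglongrightarrow> of_real pi / sin (of_real pi * z)"
proof -
  have half: "z / 2 \<notin> \<int>"
    using assms Ints_mult[OF Ints_numeral[of "num.Bit0 num.One"], of "z / 2"] by auto
  have s: "sin (of_real pi * z) \<noteq> 0"
    using assms by (rule sin_pi_times_nonzero)
  have "(\<lambda>m. (\<Sum>n<m. 1 / (z/2 + of_nat n) - 1 / (of_nat n + 1 - z/2))
           - (\<Sum>n<2*m. 1 / (z + of_nat n) - 1 / (of_nat n + 1 - z)))
        \<longlonglongrightarrow> of_real pi * cot (of_real pi * (z/2)) - of_real pi * cot (of_real pi * z)"
    by (intro tendsto_diff cot_partial_sums half
          LIMSEQ_subseq_LIMSEQ[OF cot_partial_sums[OF assms], of "\<lambda>m. 2*m", unfolded o_def])
       (auto simp: strict_mono_def)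
  also have "of_real pi * cot (of_real pi * (z/2)) - of_real pi * cot (of_real pi * z)
               = of_real pi * (1 / sin (of_real pi * z))"
    using csc_eq_cot_diff[of "of_real pi * (z/2)"] s by (simp add: right_diff_distrib)
  also have "(\<lambda>m. (\<Sum>n<m. 1 / (z/2 + of_nat n) - 1 / (of_nat n + 1 - z/2))
           - (\<Sum>n<2*m. 1 / (z + of_nat n) - 1 / (of_nat n + 1 - z)))
        = (\<lambda>m. \<Sum>n<2*m. (-1)^n * (1 / (z + of_nat n) + 1 / (of_nat n + 1 - z)))"
  proof
    fix m
    show "(\<Sum>n<m. 1 / (z/2 + of_nat n) - 1 / (of_nat n + 1 - z/2))
           - (\<Sum>n<2*m. 1 / (z + of_nat n) - 1 / (of_nat n + 1 - z))
        = (\<Sum>n<2*m. (-1)^n * (1 / (z + of_nat n) + 1 / (of_nat n + 1 - z)))"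
    proof (induction m)
      case (Suc m)
      have "z/2 + of_nat m = (z + of_nat (2*m)) / 2" "of_nat m + 1 - z/2 = (of_nat (2*m+1) + 1 - z) / 2"
        by (simp_all add: field_simps)
      moreover have "1 / (p / 2) = 1 / p + 1 / p" for p :: complex
        by (simp flip: add_divide_distrib)
      ultimately have e: "1 / (z/2 + of_nat m) = 1 / (z + of_nat (2*m)) + 1 / (z + of_nat (2*m))"
        "1 / (of_nat m + 1 - z/2) = 1 / (of_nat (2*m+1) + 1 - z) + 1 / (of_nat (2*m+1) + 1 - z)"
        by (simp_all only:)
      have split: "sum f {..<2 * Suc m} = sum f {..<2*m} + f (2*m) + f (2*m+1)" for f :: "nat \<Rightarrow> complex"
        by simp
      show ?case
        unfolding split sum.lessThan_Suc e using Suc.IH by (simp add: algebra_simps)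
    qed simp
  qed
  finally show ?thesis by simp
qed

text \<open>Regrouping: \<open>1 / (z + k)\<close> from index \<open>k\<close> is paired with
  \<open>1 / (k - z)\<close> from index \<open>k - 1\<close> instead of its own partner, which
  leaves \<open>1 / z\<close> at the start and one unpaired term at the end.\<close>

lemma csc_shift_sum:
  fixes z :: complex
  assumes "z \<notin> \<int>"
  shows "(\<Sum>n<Suc m. (-1)^n * (1 / (z + of_nat n) + 1 / (of_nat n + 1 - z)))
       = 1 / z + (\<Sum>k<m. (-1)^Suc k * (2 * z / (z\<^sup>2 - (of_nat (Suc k))\<^sup>2))) + (-1)^m / (of_nat m + 1 - z)"
proof (induction m)
  case (Suc m)
  have nz: "z + of_nat n \<noteq> 0" "of_nat n - z \<noteq> 0" for n
    using assms by (auto simp: add_eq_0_iff2)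
  have "2 * z / (z\<^sup>2 - (of_nat (Suc m))\<^sup>2) = 1 / (z + of_nat (Suc m)) - 1 / (of_nat (Suc m) - z)"
  proof -
    have "z\<^sup>2 - (of_nat (Suc m))\<^sup>2 = - ((z + of_nat (Suc m)) * (of_nat (Suc m) - z))"
      by (simp add: power2_eq_square algebra_simps)
    moreover have "2 * z / - (p * q) = 1 / p - 1 / q" if "p \<noteq> 0" "q \<noteq> 0" "p - q = 2 * z" for p q :: complex
      using that(1,2) unfolding that(3)[symmetric] by (simp add: field_simps)
    ultimately show ?thesis using nz[of "Suc m"] by simp
  qed
  then have "(-1)^Suc m * (2 * z / (z\<^sup>2 - (of_nat (Suc m))\<^sup>2))
      = (-1)^Suc m * (1 / (z + of_nat (Suc m))) + (-1)^m / (of_nat m + 1 - z)"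
    by (simp only: right_diff_distrib) (simp add: algebra_simps)
  then show ?case
    by (subst sum.lessThan_Suc, subst Suc.IH) (simp add: algebra_simps)
qed (simp add: algebra_simps)

lemma summable_inverse_sq_diff:
  fixes w :: complex
  shows "summable (\<lambda>k. (-1)^Suc k * (1 / (w - (of_nat (Suc k))\<^sup>2)))"
proof (rule summable_comparison_test_ev)
  show "summable (\<lambda>k. 2 * (1 / (real (Suc k))\<^sup>2))"
    using inverse_squares_sums by (intro summable_mult) (auto simp: sums_iff)
  obtain K :: nat where K: "real K > 2 * norm w" using reals_Archimedean2 by blast
  show "\<forall>\<^sub>F k in sequentially. norm ((-1)^Suc k * (1 / (w - (of_nat (Suc k))\<^sup>2)) :: complex) \<le> 2 * (1 / (real (Suc k))\<^sup>2)"
    using eventually_ge_at_top[of K]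
  proof eventually_elim
    case (elim k)
    have "real (Suc k) \<ge> 1" by simp
    then have "(real (Suc k))\<^sup>2 \<ge> real (Suc k)" by (simp add: self_le_power)
    then have "2 * norm w \<le> (real (Suc k))\<^sup>2" using K elim by linarith
    moreover have "norm (w - (of_nat (Suc k))\<^sup>2) \<ge> (real (Suc k))\<^sup>2 - norm w"
      using norm_triangle_ineq3[of w "(of_nat (Suc k))\<^sup>2 :: complex"]
      by (simp add: norm_power del: of_nat_Suc)
    ultimately have "norm (w - (of_nat (Suc k))\<^sup>2) \<ge> (real (Suc k))\<^sup>2 / 2" by linarith
    moreover have "(real (Suc k))\<^sup>2 / 2 > 0" by simp
    ultimately have "inverse (norm (w - (of_nat (Suc k))\<^sup>2)) \<le> inverse ((real (Suc k))\<^sup>2 / 2)"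
      by (rule le_imp_inverse_le)
    moreover have "norm ((-1)^Suc k * (1 / (w - (of_nat (Suc k))\<^sup>2))) = inverse (norm (w - (of_nat (Suc k))\<^sup>2))"
      by (simp add: norm_mult norm_divide norm_power inverse_eq_divide del: of_nat_Suc)
    moreover have "inverse ((real (Suc k))\<^sup>2 / 2) = 2 * (1 / (real (Suc k))\<^sup>2)"
      by (simp del: of_nat_Suc)
    ultimately show ?case by linarith
  qed
qed

lemma csc_sums_pi:
  fixes z :: complex
  assumes "z \<notin> \<int>"
  shows "(\<lambda>k. (-1)^Suc k * (2 * z / (z\<^sup>2 - (of_nat (Suc k))\<^sup>2))) sums
           (of_real pi / sin (of_real pi * z) - 1 / z)"
proof -
  let ?f = "\<lambda>k. (-1)^Suc k * (2 * z / (z\<^sup>2 - (of_nat (Suc k))\<^sup>2))"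
  have "summable (\<lambda>k. 2 * z * ((-1)^Suc k * (1 / (z\<^sup>2 - (of_nat (Suc k))\<^sup>2))))"
    by (intro summable_mult summable_inverse_sq_diff)
  then have sm: "summable ?f" by (simp add: mult_ac)
  \<comment> \<open>\<open>csc_partial_sums\<close> controls only even numbers of terms. The sums
    here have \<open>Suc m\<close> terms and \<open>Suc (2*m+1) = 2 * Suc m\<close>, so the
    comparison runs along odd indices; summability makes this subsequence enough.\<close>
  have sm': "strict_mono (\<lambda>m::nat. 2*m+1)" by (auto simp: strict_mono_def)
  have "filterlim (\<lambda>m. (1 - z) + of_nat m) at_infinity sequentially"
    by (rule tendsto_add_filterlim_at_infinity[OF tendsto_const tendsto_of_nat])
  from tendsto_norm_zero[OF filterlim_compose[OF tendsto_inverse_0 this]]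
  have "(\<lambda>m. norm ((-1)^m / (of_nat m + 1 - z))) \<longlonglongrightarrow> 0"
    by (simp add: norm_divide norm_power norm_inverse inverse_eq_divide algebra_simps)
  then have e: "(\<lambda>m. (-1)^m / (of_nat m + 1 - z)) \<longlonglongrightarrow> 0"
    by (rule tendsto_norm_zero_cancel)
  have "(\<lambda>m. 1 / z + (\<Sum>k<m. ?f k) + (-1)^m / (of_nat m + 1 - z)) \<longlonglongrightarrow> 1 / z + suminf ?f + 0"
    using sm by (intro tendsto_add tendsto_const e summable_LIMSEQ)
  then have "(\<lambda>m. \<Sum>n<Suc m. (-1)^n * (1 / (z + of_nat n) + 1 / (of_nat n + 1 - z)))
      \<longlonglongrightarrow> 1 / z + suminf ?f + 0"
    by (simp only: csc_shift_sum[OF assms])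
  from LIMSEQ_subseq_LIMSEQ[OF this sm']
  have "(\<lambda>m. \<Sum>n<2 * Suc m. (-1)^n * (1 / (z + of_nat n) + 1 / (of_nat n + 1 - z)))
      \<longlonglongrightarrow> 1 / z + suminf ?f + 0"
    by (simp only: o_def mult_Suc_right add_2_eq_Suc Suc_eq_plus1[symmetric])
  moreover have "(\<lambda>m. \<Sum>n<2 * Suc m. (-1)^n * (1 / (z + of_nat n) + 1 / (of_nat n + 1 - z)))
      \<longlonglongrightarrow> of_real pi / sin (of_real pi * z)"
    by (rule LIMSEQ_Suc[OF csc_partial_sums[OF assms]])
  ultimately have "1 / z + suminf ?f + 0 = of_real pi / sin (of_real pi * z)"
    by (rule LIMSEQ_unique)
  then have "suminf ?f = of_real pi / sin (of_real pi * z) - 1 / z"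
    unfolding add_0_right by (rule eq_diff_eq[THEN iffD2, OF trans[OF add.commute]])
  with summable_sums[OF sm] show ?thesis by (simp only:)
qed

lemma csc_sums:
  fixes z :: complex
  assumes "sin z \<noteq> 0"
  shows "(\<lambda>k. (-1)^Suc k * (2 * z / (z\<^sup>2 - (of_nat (Suc k) * of_real pi)\<^sup>2))) sums (1 / sin z - 1 / z)"
proof -
  have ni: "z / of_real pi \<notin> \<int>"
  proof
    assume "z / of_real pi \<in> \<int>"
    then obtain n :: int where "z / of_real pi = of_int n" by (auto elim: Ints_cases)
    then have "z = of_real (of_int n * pi)" by (simp add: field_simps)
    then show False using assms by (simp add: sin_eq_0)
  qed
  have scale: "inverse c * (s * (2 * (z / c) / ((z / c)\<^sup>2 - q\<^sup>2))) = s * (2 * z / (z\<^sup>2 - (q * c)\<^sup>2))"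
    if "c \<noteq> 0" for c s q :: complex
  proof -
    have "(z / c)\<^sup>2 - q\<^sup>2 = (z\<^sup>2 - (q * c)\<^sup>2) / c\<^sup>2"
      using that by (simp add: power_divide power_mult_distrib diff_divide_distrib)
    then show ?thesis using that by (simp add: power2_eq_square)
  qed
  have pi: "complex_of_real pi \<noteq> 0" by simp
  have "inverse c * (c / sin (c * (z / c)) - 1 / (z / c)) = 1 / sin z - 1 / z" if "c \<noteq> 0" for c
    using that by (simp add: right_diff_distrib)
  from sums_mult[OF csc_sums_pi[OF ni], of "inverse (of_real pi)", unfolded scale[OF pi] this[OF pi]]
  show ?thesis .
qed

lemma csc_sums_real:
  fixes x :: real
  assumes "sin x \<noteq> 0"
  shows "(\<lambda>k. (-1)^Suc k * (2 * x / (x\<^sup>2 - (real (Suc k) * pi)\<^sup>2))) sums (1 / sin x - 1 / x)"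
proof -
  have "sin (complex_of_real x) \<noteq> 0" using assms by (simp add: sin_of_real)
  from csc_sums[OF this] 
  have "(\<lambda>k. complex_of_real ((-1)^Suc k * (2 * x / (x\<^sup>2 - (real (Suc k) * pi)\<^sup>2)))) sums of_real (1 / sin x - 1 / x)"
    by (simp only: sin_of_real of_real_mult of_real_divide of_real_power of_real_minus of_real_diff
          of_real_1 of_real_numeral of_real_of_nat_eq)
  then show ?thesis by (rule sums_of_real_iff[THEN iffD1])
qed

text \<open>The cosecant expansion at \<open>\<i> * t\<close>, where the sine becomes
  \<open>\<i> * sinh t\<close> and the square of the argument changes sign.\<close>

lemma csch_sums:
  fixes t :: real
  assumes "t > 0"
  shows "(\<lambda>k. (-1)^Suc k * (2 * t / (t\<^sup>2 + (real (Suc k) * pi)\<^sup>2))) sums (1 / sinh t - 1 / t)"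
proof -
  have s: "sin (\<i> * complex_of_real t) = \<i> * of_real (sinh t)"
    by (simp add: sin_exp_eq sinh_def scaleR_conv_of_real exp_minus field_simps flip: exp_of_real)
  have "sin (\<i> * complex_of_real t) \<noteq> 0" using assms by (simp add: s)
  from sums_mult[OF csc_sums[OF this], of \<i>]
  have "(\<lambda>k. \<i> * ((-1)^Suc k * (2 * (\<i> * of_real t) / ((\<i> * of_real t)\<^sup>2 - (of_nat (Suc k) * of_real pi)\<^sup>2))))
          sums (\<i> * (1 / sin (\<i> * complex_of_real t) - 1 / (\<i> * of_real t)))" .
  also have "\<i> * (1 / sin (\<i> * complex_of_real t) - 1 / (\<i> * of_real t)) = of_real (1 / sinh t - 1 / t)"
    unfolding s by (simp add: right_diff_distrib)
  finally
  have "(\<lambda>k. \<i> * ((-1)^Suc k * (2 * (\<i> * of_real t) / ((\<i> * of_real t)\<^sup>2 - (of_nat (Suc k) * of_real pi)\<^sup>2))))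
          sums of_real (1 / sinh t - 1 / t)"
    .
  also have "(\<lambda>k. \<i> * ((-1)^Suc k * (2 * (\<i> * of_real t) / ((\<i> * of_real t)\<^sup>2 - (of_nat (Suc k) * of_real pi)\<^sup>2))))
     = (\<lambda>k. complex_of_real ((-1)^Suc k * (2 * t / (t\<^sup>2 + (real (Suc k) * pi)\<^sup>2))))"
  proof
    fix k
    have "(\<i> * complex_of_real t)\<^sup>2 - (of_nat (Suc k) * of_real pi)\<^sup>2 = - of_real (t\<^sup>2 + (real (Suc k) * pi)\<^sup>2)"
      by (simp add: power_mult_distrib)
    moreover have "\<i> * (c * (2 * (\<i> * of_real t) / - w)) = c * (2 * of_real t / w)" for c w :: complex
      by (cases "w = 0") (simp_all add: field_simps)
    ultimately show "\<i> * ((-1)^Suc k * (2 * (\<i> * of_real t) / ((\<i> * of_real t)\<^sup>2 - (of_nat (Suc k) * of_real pi)\<^sup>2)))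
       = complex_of_real ((-1)^Suc k * (2 * t / (t\<^sup>2 + (real (Suc k) * pi)\<^sup>2)))"
      by (simp only: of_real_mult of_real_divide of_real_power of_real_minus of_real_1 of_real_numeral)
  qed
  finally show ?thesis by (rule sums_of_real_iff[THEN iffD1])
qed

section \<open>Mellin integrals on the half-line\<close>

abbreviation has_halfline_integral :: "(real \<Rightarrow> 'a :: {banach, second_countable_topology}) \<Rightarrow> 'a \<Rightarrow> bool" where
  "has_halfline_integral f v \<equiv> has_bochner_integral lborel (\<lambda>t. indicator {0<..} t *\<^sub>R f t) v"

lemma has_halfline_integral_iff:
  "has_halfline_integral f v \<longleftrightarrow>
     set_integrable lborel {0<..} f \<and> set_lebesgue_integral lborel {0<..} f = v"
  by (simp add: has_bochner_integral_iff set_integrable_def set_lebesgue_integral_def)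

lemma has_halfline_integral_cong:
  assumes "\<And>t. t > 0 \<Longrightarrow> f t = g t"
  shows "has_halfline_integral f v \<longleftrightarrow> has_halfline_integral g v"
  by (rule has_bochner_integral_cong) (use assms in \<open>auto simp: indicator_def\<close>)

lemma has_halfline_integral_mult:
  fixes f :: "real \<Rightarrow> real"
  assumes "has_halfline_integral f v"
  shows "has_halfline_integral (\<lambda>t. c * f t) (c * v)"
  using has_bochner_integral_mult_right[of c, OF assms] by (simp add: mult.left_commute)

text \<open>Passage between the gauge integral, in which substitutions and Gamma integrals are
  carried out, and the Bochner integral, in which limits are taken.\<close>

lemma absolutely_integrable_halfline_iff:
  fixes f :: "real \<Rightarrow> 'a :: euclidean_space"
  assumes [measurable]: "f \<in> borel_measurable borel"
  shows "f absolutely_integrable_on {0<..} \<and> integral {0<..} f = v \<longleftrightarrow> has_halfline_integral f v"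
proof -
  have eq: "f absolutely_integrable_on {0<..} \<longleftrightarrow> set_integrable lborel {0<..} f"
    unfolding set_integrable_def by (rule integrable_completion) measurable
  show ?thesis
    unfolding eq has_halfline_integral_iff
    using set_borel_integral_eq_integral(2)[of "{0<..}" f] by auto
qed

lemma Beta_reflection:
  fixes p :: real
  shows "Beta p (1 - p) = pi / sin (pi * p)"
proof -
  have "complex_of_real (Gamma p * Gamma (1 - p)) = complex_of_real (pi / sin (pi * p))"
    by (simp only: of_real_mult of_real_divide sin_of_real[symmetric] Gamma_complex_of_real[symmetric]
          of_real_diff of_real_1 Gamma_reflection_complex)
  then show ?thesis
    unfolding of_real_eq_iff by (simp add: Beta_def)
qed

text \<open>The substitution \<open>u = t^2 / (t^2 + a^2)\<close> maps the half-line onto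
  \<open>(0, 1)\<close> and produces the Beta integral with parameters \<open>s / 2\<close> and
  \<open>1 - s / 2\<close>, which the reflection formula evaluates.\<close>

lemma halfline_integral_powr_over_square:
  fixes s a :: real
  assumes s: "0 < s" "s < 2" and a: "a > 0"
  shows "has_halfline_integral (\<lambda>t. t powr (s - 1) / (t\<^sup>2 + a\<^sup>2)) (pi / (2 * sin (pi * s / 2)) * a powr (s - 2))"
proof -
  define p where "p = s / 2"
  have p: "0 < p" "p < 1" using s by (auto simp: p_def)
  define f where "f = (\<lambda>u::real. u powr (p - 1) * (1 - u) powr (1 - p - 1))"
  define g where "g = (\<lambda>t. t\<^sup>2 / (t\<^sup>2 + a\<^sup>2))"
  define g' where "g' = (\<lambda>t. 2 * t * a\<^sup>2 / (t\<^sup>2 + a\<^sup>2)\<^sup>2)"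
  have pos: "t\<^sup>2 + a\<^sup>2 > 0" for t using a by (simp add: add_nonneg_pos)
  have int_f: "(f has_integral pi / sin (pi * p)) {0<..<1}"
    using has_integral_Beta_real[of p "1 - p"] p by (simp add: f_def Beta_reflection has_integral_Icc_iff_Ioo)
  then have "f absolutely_integrable_on {0<..<1}"
    by (intro nonnegative_absolutely_integrable_1) (auto simp: f_def integrable_on_def)
  moreover have img: "g ` {0<..} = {0<..<1}"
  proof (intro equalityI subsetI)
    fix u assume "u \<in> g ` {0<..}"
    then show "u \<in> {0<..<1}" using a pos by (auto simp: g_def)
  next
    fix u :: real assume u: "u \<in> {0<..<1}"
    \<comment> \<open>This is \<open>g t = u\<close> solved for \<open>t\<close>.\<close>
    define t where "t = a * sqrt (u / (1 - u))"
    have t2: "t\<^sup>2 = a\<^sup>2 * u / (1 - u)" using u by (simp add: t_def power_mult_distrib)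
    have "t\<^sup>2 + a\<^sup>2 = a\<^sup>2 / (1 - u)" using u unfolding t2 by (simp add: field_simps)
    then have "g t = u" using u a unfolding g_def t2 by simp
    moreover have "t > 0" using u a by (simp add: t_def)
    ultimately show "u \<in> g ` {0<..}" by force
  qed
  moreover have inj: "inj_on g {0<..}"
  proof (rule inj_onI)
    fix t u assume tu: "t \<in> {0<..}" "u \<in> {0<..}" "g t = g u"
    then have "t\<^sup>2 * (u\<^sup>2 + a\<^sup>2) = u\<^sup>2 * (t\<^sup>2 + a\<^sup>2)"
      using pos[of t] pos[of u] by (simp add: g_def frac_eq_eq)
    then have "t\<^sup>2 = u\<^sup>2" using a by (simp add: algebra_simps)
    with tu show "t = u" by simp
  qed
  moreover have der: "(g has_field_derivative g' t) (at t within {0<..})" for t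
    unfolding g_def g'_def using pos[of t]
    by (auto intro!: derivative_eq_intros simp: power2_eq_square algebra_simps)
  ultimately have "(\<lambda>t. \<bar>g' t\<bar> * f (g t)) absolutely_integrable_on {0<..} \<and>
      integral {0<..} (\<lambda>t. \<bar>g' t\<bar> * f (g t)) = pi / sin (pi * p)"
    using int_f by (subst has_absolute_integral_change_of_variables_1') auto
  then have "has_halfline_integral (\<lambda>t. \<bar>g' t\<bar> * f (g t)) (pi / sin (pi * p))"
    by (subst (asm) absolutely_integrable_halfline_iff) (auto simp: g'_def f_def g_def)
  \<comment> \<open>The pulled-back integrand is \<open>2 * a powr (2 - s)\<close> times the wanted
    one; the factor removes this constant.\<close>
  then have "has_halfline_integral (\<lambda>t. a powr (s - 2) / 2 * (\<bar>g' t\<bar> * f (g t))) (a powr (s - 2) / 2 * (pi / sin (pi * p)))"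
    by (rule has_halfline_integral_mult)
  also have "a powr (s - 2) / 2 * (pi / sin (pi * p)) = pi / (2 * sin (pi * s / 2)) * a powr (s - 2)"
    by (simp add: p_def)
  finally show ?thesis
  proof (rule has_halfline_integral_cong[THEN iffD1, rotated])
    fix t :: real assume t: "t > 0"
    define q where "q = t\<^sup>2 + a\<^sup>2"
    have q: "q > 0" using pos q_def by simp
    have *: "1 - g t = a\<^sup>2 / q" using a diff_divide_distrib[of q "t\<^sup>2" q] q by (simp add: g_def q_def)
    have "f (g t) = (t\<^sup>2) powr (p - 1) * (a\<^sup>2) powr (-p) * (q powr (1 - p) * q powr p)"
      unfolding f_def * using q t a
      by (simp add: g_def powr_divide powr_minus_divide powr_diff flip: q_def)
    also have "q powr (1 - p) * q powr p = q"
      using q by (simp flip: powr_add)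
    also have "(t\<^sup>2) powr (p - 1) = t powr (s - 2)"
      using t by (simp add: p_def powr_powr algebra_simps flip: powr_numeral)
    also have "(a\<^sup>2) powr (-p) = a powr (-s)"
      using a by (simp add: p_def powr_powr algebra_simps flip: powr_numeral)
    finally have 1: "f (g t) = t powr (s - 2) * a powr (-s) * q" .
    have 2: "\<bar>g' t\<bar> = 2 * t * a\<^sup>2 / q\<^sup>2" using t q by (simp add: g'_def q_def)
    have "a powr (s - 2) * a powr (-s) * a\<^sup>2 = 1"
      using a by (simp add: powr_diff powr_minus)
    moreover have "t powr (s - 2) * t = t powr (s - 1)"
      using t by (simp add: powr_diff power2_eq_square)
    moreover have "A / 2 * (2 * t * C / q\<^sup>2 * (T * B * q)) = (A * B * C) * (T * t) / q" for A B C T :: real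
      using q by (simp add: power2_eq_square)
    ultimately have "a powr (s - 2) / 2 * (2 * t * a\<^sup>2 / q\<^sup>2 * (t powr (s - 2) * a powr (-s) * q)) = t powr (s - 1) / q"
      by simp
    then show "a powr (s - 2) / 2 * (\<bar>g' t\<bar> * f (g t)) = t powr (s - 1) / (t\<^sup>2 + a\<^sup>2)"
      unfolding 1 2 by (simp add: q_def)
  qed
qed

text \<open>Partial fractions in \<open>t^2\<close> reduce this to two instances of the previous
  integral, weighted by \<open>a^2\<close> and \<open>b^2\<close>.\<close>

lemma halfline_integral_powr_over_two_squares:
  fixes s a b :: real
  assumes s: "0 < s" "s < 2" and ab: "a > 0" "b > 0" "a \<noteq> b"
  shows "has_halfline_integral (\<lambda>t. t powr (s + 1) / ((t\<^sup>2 + a\<^sup>2) * (t\<^sup>2 + b\<^sup>2)))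
           (pi / (2 * sin (pi * s / 2)) * ((a powr s - b powr s) / (a\<^sup>2 - b\<^sup>2)))"
proof -
  define c where "c = pi / (2 * sin (pi * s / 2))"
  have ne: "a\<^sup>2 \<noteq> b\<^sup>2" using ab by simp
  have "has_halfline_integral (\<lambda>t. (a\<^sup>2 * (t powr (s - 1) / (t\<^sup>2 + a\<^sup>2)) - b\<^sup>2 * (t powr (s - 1) / (t\<^sup>2 + b\<^sup>2))) / (a\<^sup>2 - b\<^sup>2))
     ((a\<^sup>2 * (c * a powr (s - 2)) - b\<^sup>2 * (c * b powr (s - 2))) / (a\<^sup>2 - b\<^sup>2))"
    using has_bochner_integral_divide_zero[OF has_bochner_integral_diff[OF
       has_bochner_integral_mult_right[OF halfline_integral_powr_over_square[OF s ab(1)], of "a\<^sup>2"]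
       has_bochner_integral_mult_right[OF halfline_integral_powr_over_square[OF s ab(2)], of "b\<^sup>2"]], of "a\<^sup>2 - b\<^sup>2"]
    by (simp add: c_def algebra_simps)
  also have "(a\<^sup>2 * (c * a powr (s - 2)) - b\<^sup>2 * (c * b powr (s - 2))) / (a\<^sup>2 - b\<^sup>2)
     = c * ((a powr s - b powr s) / (a\<^sup>2 - b\<^sup>2))"
    using ab by (simp add: powr_diff algebra_simps)
  finally show ?thesis unfolding c_def
  proof (rule has_halfline_integral_cong[THEN iffD1, rotated])
    fix t :: real assume t: "t > 0"
    have pos: "t\<^sup>2 + a\<^sup>2 > 0" "t\<^sup>2 + b\<^sup>2 > 0" using ab by (simp_all add: add_nonneg_pos)
    have "t powr (s + 1) = t powr (s - 1) * t\<^sup>2" using t by (simp add: powr_add powr_diff power2_eq_square)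
    moreover have "(x * (r / (y + x)) - z * (r / (y + z))) / (x - z) = r * y / ((y + x) * (y + z))"
      if "y + x > 0" "y + z > 0" "x \<noteq> z" for x y z r :: real
    proof -
      have "x * (r / (y + x)) - z * (r / (y + z)) = r * y * (x - z) / ((y + x) * (y + z))"
        using that by (simp add: field_simps)
      then show ?thesis using that by simp
    qed
    from this[OF pos ne] 
    have "(a\<^sup>2 * (t powr (s - 1) / (t\<^sup>2 + a\<^sup>2)) - b\<^sup>2 * (t powr (s - 1) / (t\<^sup>2 + b\<^sup>2))) / (a\<^sup>2 - b\<^sup>2)
       = t powr (s - 1) * t\<^sup>2 / ((t\<^sup>2 + a\<^sup>2) * (t\<^sup>2 + b\<^sup>2))" by blast
    ultimately show "(a\<^sup>2 * (t powr (s - 1) / (t\<^sup>2 + a\<^sup>2)) - b\<^sup>2 * (t powr (s - 1) / (t\<^sup>2 + b\<^sup>2))) / (a\<^sup>2 - b\<^sup>2)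
       = t powr (s + 1) / ((t\<^sup>2 + a\<^sup>2) * (t\<^sup>2 + b\<^sup>2))" by simp
  qed
qed

section \<open>The pole series near the origin\<close>

text \<open>Peeling off the first term leaves \<open>f 0\<close> minus a sum of the same kind for
  the shifted sequence, so the induction runs over all \<open>f\<close>. The bounds do not depend on
  \<open>n\<close>, as a majorant requires.\<close>

lemma alternating_partial_sum_bounds:
  fixes f :: "nat \<Rightarrow> real"
  assumes "\<And>k. 0 \<le> f k" "\<And>k. f (Suc k) \<le> f k"
  shows "0 \<le> (\<Sum>k<n. (-1)^k * f k) \<and> (\<Sum>k<n. (-1)^k * f k) \<le> f 0"
  using assms
proof (induction n arbitrary: f)
  case (Suc n)
  have "(\<Sum>k<Suc n. (-1)^k * f k) = f 0 - (\<Sum>k<n. (-1)^k * f (Suc k))"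
    unfolding sum.lessThan_Suc_shift by (simp add: sum_negf)
  moreover have "0 \<le> (\<Sum>k<n. (-1)^k * f (Suc k)) \<and> (\<Sum>k<n. (-1)^k * f (Suc k)) \<le> f (Suc 0)"
    by (rule Suc.IH) (use Suc.prems in auto)
  ultimately show ?case using Suc.prems(2)[of 0] by linarith
qed auto

lemma borel_measurable_sinh [measurable]: "(sinh :: real \<Rightarrow> real) \<in> borel_measurable borel"
  by (intro borel_measurable_continuous_onI continuous_intros)

text \<open>On \<open>(0, pi)\<close> the sine is positive and \<open>x\<close> avoids every pole.
  This interval suffices, since analytic continuation takes over from there.\<close>

lemma H_fun_pole_series:
  fixes \<beta> x :: real
  assumes \<beta>: "0 < \<beta>" "\<beta> < 2" and x: "0 < x" "x < pi"
  shows "H_fun \<beta> x = 2 * x * sin x * pole_series \<beta> x"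
proof -
  define a where "a = (\<lambda>k. real (Suc k) * pi)"
  define c where "c = pi / (2 * sin (pi * \<beta> / 2))"
  have "sin (pi * \<beta> / 2) > 0" using \<beta> by (intro sin_gt_zero) auto
  then have c: "c > 0" by (simp add: c_def)
  have a: "a k > 0" "x \<noteq> a k" for k
  proof -
    have "a k \<ge> pi" using pi_gt_zero by (simp add: a_def)
    then show "a k > 0" "x \<noteq> a k" using x by auto
  qed
  have s: "sin x > 0" using x by (simp add: sin_gt_zero)
  \<comment> \<open>For positive \<open>t\<close>, \<open>A n\<close> is the integrand of
    \<open>I\<close> with \<open>1 / sinh t\<close> cut off after \<open>n\<close> partial
    fractions, arranged so that every summand has a known integral.\<close>
  define A where "A = (\<lambda>n t. t powr (\<beta> - 1) / (t\<^sup>2 + x\<^sup>2)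
     + (\<Sum>k<n. (-1)^Suc k * 2 * (t powr (\<beta> + 1) / ((t\<^sup>2 + x\<^sup>2) * (t\<^sup>2 + (a k)\<^sup>2)))))"
  define I where "I = set_lebesgue_integral lborel {0<..} (\<lambda>t. t powr \<beta> / (t\<^sup>2 + x\<^sup>2) * (1 / sinh t))"
  have A_int: "has_halfline_integral (A n) (c * x powr (\<beta> - 2)
     + (\<Sum>k<n. (-1)^Suc k * 2 * (c * ((x powr \<beta> - (a k) powr \<beta>) / (x\<^sup>2 - (a k)\<^sup>2)))))" for n
    unfolding A_def scaleR_add_right scaleR_sum_right
    unfolding c_def
    by (intro has_bochner_integral_add has_bochner_integral_sum has_halfline_integral_mult
          halfline_integral_powr_over_square[OF \<beta> x(1)]
          halfline_integral_powr_over_two_squares[OF \<beta> x(1) a])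
  have A_eq: "A n t = t powr \<beta> / (t\<^sup>2 + x\<^sup>2) * (1 / t + (\<Sum>k<n. (-1)^Suc k * (2 * t / (t\<^sup>2 + (a k)\<^sup>2))))"
    if "t > 0" for n t
  proof -
    have "t powr (\<beta> - 1) = t powr \<beta> * (1 / t)" "t powr (\<beta> + 1) = t powr \<beta> * t"
      using that by (simp_all add: powr_diff powr_add)
    then show ?thesis
      by (simp add: A_def distrib_left sum_distrib_left mult_ac)
  qed
  have lim: "(\<lambda>n. A n t) \<longlonglongrightarrow> t powr \<beta> / (t\<^sup>2 + x\<^sup>2) * (1 / sinh t)" if t: "t > 0" for t
  proof -
    have "(\<lambda>n. 1 / t + (\<Sum>k<n. (-1)^Suc k * (2 * t / (t\<^sup>2 + (a k)\<^sup>2)))) \<longlonglongrightarrow> 1 / t + (1 / sinh t - 1 / t)"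
      using csch_sums[OF t] unfolding sums_def a_def by (intro tendsto_add tendsto_const)
    then show ?thesis unfolding A_eq[OF t] by (intro tendsto_mult tendsto_const) simp
  qed
  \<comment> \<open>The alternating sum lies between 0 and its first term, which is at most
    \<open>2 / t\<close>; with the leading \<open>1 / t\<close> this gives the factor 3 and an
    integrable majorant free of \<open>n\<close>.\<close>
  have bound: "\<bar>A n t\<bar> \<le> 3 * (t powr (\<beta> - 1) / (t\<^sup>2 + x\<^sup>2))" if t: "t > 0" for n t
  proof -
    define f where "f = (\<lambda>k. 2 * t / (t\<^sup>2 + (a k)\<^sup>2))"
    have "0 \<le> f k" for k using t by (simp add: f_def)
    moreover have "f (Suc k) \<le> f k" for k
    proof -
      have "(a k)\<^sup>2 \<le> (a (Suc k))\<^sup>2" using a(1)[of k] by (intro power_mono) (auto simp: a_def)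
      then show ?thesis using t a(1)[of k] unfolding f_def
        by (intro divide_left_mono) (auto intro!: mult_pos_pos add_pos_nonneg)
    qed
    ultimately have "0 \<le> (\<Sum>k<n. (-1)^k * f k) \<and> (\<Sum>k<n. (-1)^k * f k) \<le> f 0"
      by (rule alternating_partial_sum_bounds)
    moreover have "f 0 \<le> 2 * t / t\<^sup>2" unfolding f_def using t a(1)[of 0]
      by (intro divide_left_mono) (auto intro!: mult_pos_pos add_pos_nonneg)
    moreover have "2 * t / t\<^sup>2 = 2 * (1 / t)" using t by (simp add: power2_eq_square)
    moreover have "(\<Sum>k<n. (-1)^Suc k * f k) = - (\<Sum>k<n. (-1)^k * f k)"
      by (simp add: sum_negf)
    moreover have "1 / t > 0" using t by simp
    ultimately have "\<bar>1 / t + (\<Sum>k<n. (-1)^Suc k * f k)\<bar> \<le> 3 * (1 / t)"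
      unfolding abs_le_iff by linarith
    then have "t powr \<beta> / (t\<^sup>2 + x\<^sup>2) * \<bar>1 / t + (\<Sum>k<n. (-1)^Suc k * f k)\<bar> \<le> t powr \<beta> / (t\<^sup>2 + x\<^sup>2) * (3 * (1 / t))"
      by (intro mult_left_mono) auto
    moreover have "A n t = t powr \<beta> / (t\<^sup>2 + x\<^sup>2) * (1 / t + (\<Sum>k<n. (-1)^Suc k * f k))"
      unfolding A_eq[OF t] f_def ..
    ultimately show ?thesis
      using t by (simp add: abs_mult powr_diff mult_ac)
  qed
  have "(\<lambda>n. set_lebesgue_integral lborel {0<..} (A n)) \<longlonglongrightarrow> I"
    unfolding I_def set_lebesgue_integral_def
  proof (rule integral_dominated_convergence)
    show "integrable lborel (\<lambda>t. indicator {0<..} t *\<^sub>R (3 * (t powr (\<beta> - 1) / (t\<^sup>2 + x\<^sup>2))))"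
      by (rule integrable.intros, rule has_halfline_integral_mult,
          rule halfline_integral_powr_over_square[OF \<beta> x(1)])
    show "AE t in lborel. (\<lambda>n. indicator {0<..} t *\<^sub>R A n t) \<longlonglongrightarrow>
            indicator {0<..} t *\<^sub>R (t powr \<beta> / (t\<^sup>2 + x\<^sup>2) * (1 / sinh t))"
      using lim by (auto simp: indicator_def)
    show "AE t in lborel. norm (indicator {0<..} t *\<^sub>R A n t)
            \<le> indicator {0<..} t *\<^sub>R (3 * (t powr (\<beta> - 1) / (t\<^sup>2 + x\<^sup>2)))" for n
      using bound by (auto simp: indicator_def)
  qed (auto simp: A_def)
  then have L: "(\<lambda>n. c * x powr (\<beta> - 2)
     + (\<Sum>k<n. (-1)^Suc k * 2 * (c * ((x powr \<beta> - (a k) powr \<beta>) / (x\<^sup>2 - (a k)\<^sup>2))))) \<longlonglongrightarrow> I"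
    by (simp only: A_int[unfolded has_halfline_integral_iff, THEN conjunct2])
  have S1: "(\<lambda>n. \<Sum>k<n. (-1)^Suc k * (2 * x / (x\<^sup>2 - (a k)\<^sup>2))) \<longlonglongrightarrow> 1 / sin x - 1 / x"
    using csc_sums_real[of x] s unfolding sums_def a_def by simp
  \<comment> \<open>The closed form of the integral of \<open>A n\<close> is solved for the partial
    sum of the pole series. The contributions of \<open>x powr \<beta>\<close> form the cosecant
    expansion, whose limit is \<open>S1\<close>.\<close>
  have "(\<lambda>n. (x powr (\<beta> - 2) + x powr \<beta> / x * (\<Sum>k<n. (-1)^Suc k * (2 * x / (x\<^sup>2 - (a k)\<^sup>2)))
       - (c * x powr (\<beta> - 2)
     + (\<Sum>k<n. (-1)^Suc k * 2 * (c * ((x powr \<beta> - (a k) powr \<beta>) / (x\<^sup>2 - (a k)\<^sup>2))))) / c) / 2)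
      \<longlonglongrightarrow> (x powr (\<beta> - 2) + x powr \<beta> / x * (1 / sin x - 1 / x) - I / c) / 2"
    using c by (intro tendsto_intros S1 L) auto
  also have "(\<lambda>n. (x powr (\<beta> - 2) + x powr \<beta> / x * (\<Sum>k<n. (-1)^Suc k * (2 * x / (x\<^sup>2 - (a k)\<^sup>2)))
       - (c * x powr (\<beta> - 2)
     + (\<Sum>k<n. (-1)^Suc k * 2 * (c * ((x powr \<beta> - (a k) powr \<beta>) / (x\<^sup>2 - (a k)\<^sup>2))))) / c) / 2)
     = (\<lambda>n. \<Sum>k<n. series_term \<beta> x (Suc k))"
  proof
    fix n
    have 1: "(\<Sum>k<n. (-1)^Suc k * 2 * (c * ((x powr \<beta> - (a k) powr \<beta>) / (x\<^sup>2 - (a k)\<^sup>2))))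
        = c * (x powr \<beta> / x * (\<Sum>k<n. (-1)^Suc k * (2 * x / (x\<^sup>2 - (a k)\<^sup>2))) - 2 * (\<Sum>k<n. series_term \<beta> x (Suc k)))"
      unfolding sum_distrib_left sum_subtractf[symmetric]
    proof (rule sum.cong[OF refl])
      fix k
      define e where "e = (-1::real)^Suc k"
      define d where "d = x\<^sup>2 - (a k)\<^sup>2"
      have st: "series_term \<beta> x (Suc k) = e * (a k powr \<beta> / d)"
        unfolding series_term_def e_def d_def a_def ..
      show "(-1)^Suc k * 2 * (c * ((x powr \<beta> - (a k) powr \<beta>) / (x\<^sup>2 - (a k)\<^sup>2)))
        = c * (x powr \<beta> / x * ((-1)^Suc k * (2 * x / (x\<^sup>2 - (a k)\<^sup>2))) - 2 * series_term \<beta> x (Suc k))"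
        unfolding st e_def[symmetric] d_def[symmetric] using x by (simp add: diff_divide_distrib algebra_simps)
    qed
    show "(x powr (\<beta> - 2) + x powr \<beta> / x * (\<Sum>k<n. (-1)^Suc k * (2 * x / (x\<^sup>2 - (a k)\<^sup>2)))
       - (c * x powr (\<beta> - 2)
     + (\<Sum>k<n. (-1)^Suc k * 2 * (c * ((x powr \<beta> - (a k) powr \<beta>) / (x\<^sup>2 - (a k)\<^sup>2))))) / c) / 2
      = (\<Sum>k<n. series_term \<beta> x (Suc k))"
      unfolding 1 distrib_left[symmetric] using c by simp
  qed
  finally have "pole_series \<beta> x = (x powr (\<beta> - 2) + x powr \<beta> / x * (1 / sin x - 1 / x) - I / c) / 2"
    unfolding pole_series_def sums_def[symmetric] by (simp add: sums_iff)
  also have "x powr (\<beta> - 2) = x powr \<beta> / x * (1 / x)"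
    using x by (simp add: powr_diff power2_eq_square)
  finally have "2 * x * sin x * pole_series \<beta> x = x powr \<beta> - x * sin x * I / c"
    using x s by (simp add: field_simps)
  also have "x * sin x * I = H_int \<beta> x"
  proof -
    have "H_int \<beta> x = set_lebesgue_integral lborel {0<..} (\<lambda>t. x * sin x * (t powr \<beta> / (t\<^sup>2 + x\<^sup>2) * (1 / sinh t)))"
      using x by (simp add: H_int_def mult_ac add.commute)
    then show ?thesis unfolding I_def set_integral_mult_right ..
  qed
  finally show ?thesis using x by (simp add: H_fun_def c_def)
qed

section \<open>Reduction of the exponent by two\<close>

text \<open>Equivalent to \<open>1 + 2 * t \<le> exp (2 * t)\<close>. It bounds
  \<open>t powr \<alpha> / sinh t\<close> by a sum of two Gamma integrands, with exponents
  \<open>\<alpha> - 1\<close> and \<open>\<alpha>\<close>.\<close>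

lemma sinh_lower_bound:
  fixes t :: real
  assumes "t > 0"
  shows "t * exp t / (1 + 2 * t) \<le> sinh t"
proof -
  have "exp t * (1 + 2 * t) \<le> exp t * exp (2 * t)"
    by (intro mult_left_mono exp_ge_add_one_self) auto
  then have "1 + 2 * t \<le> exp t * exp t" by (simp flip: exp_add)
  then have "exp (- t) * (1 + 2 * t) \<le> exp t"
    by (simp add: exp_minus field_simps)
  moreover have "exp t * (1 + 2 * t) = exp t + 2 * (t * exp t)" by (simp add: algebra_simps)
  ultimately have "2 * (t * exp t) \<le> (exp t - exp (- t)) * (1 + 2 * t)"
    by (simp add: algebra_simps)
  then have "t * exp t \<le> sinh t * (1 + 2 * t)" by (simp add: sinh_field_def)
  then show ?thesis using assms by (simp add: pos_divide_le_eq)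
qed

lemma set_integrable_powr_over_exp:
  fixes s :: real
  assumes "s > 0"
  shows "set_integrable lborel {0<..} (\<lambda>t. t powr (s - 1) / exp t)"
proof -
  have "(\<lambda>t. t powr (s - 1) / exp t) absolutely_integrable_on {0..}"
    using Gamma_integral_real[OF assms] by (intro nonnegative_absolutely_integrable_1) (auto simp: integrable_on_def)
  then have "(\<lambda>t. t powr (s - 1) / exp t) absolutely_integrable_on {0<..}"
    by (rule set_integrable_subset) auto
  moreover have "(\<lambda>t. t powr (s - 1) / exp t) \<in> borel_measurable borel" by measurable
  ultimately show ?thesis
    using absolutely_integrable_halfline_iff unfolding has_halfline_integral_iff by blast
qed

lemma set_integrable_powr_over_sinh:
  fixes \<alpha> :: real
  assumes "\<alpha> > 0"
  shows "set_integrable lborel {0<..} (\<lambda>t. t powr \<alpha> / sinh t)"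
proof (rule set_integrable_bound)
  show "set_integrable lborel {0<..} (\<lambda>t. t powr (\<alpha> - 1) / exp t + 2 * (t powr (\<alpha> + 1 - 1) / exp t))"
    using assms by (intro set_integral_add set_integrable_mult_right set_integrable_powr_over_exp) auto
  show "set_borel_measurable lborel {0<..} (\<lambda>t. t powr \<alpha> / sinh t)"
    unfolding set_borel_measurable_def by measurable
  show "AE t in lborel. t \<in> {0<..} \<longrightarrow> norm (t powr \<alpha> / sinh t)
          \<le> norm (t powr (\<alpha> - 1) / exp t + 2 * (t powr (\<alpha> + 1 - 1) / exp t))"
  proof (intro AE_I2 impI)
    fix t :: real assume "t \<in> {0<..}"
    then have t: "t > 0" by simp
    have "t powr \<alpha> / sinh t \<le> t powr \<alpha> / (t * exp t / (1 + 2 * t))"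
      using t by (intro divide_left_mono sinh_lower_bound) auto
    also have "\<dots> = t powr (\<alpha> - 1) / exp t + 2 * (t powr (\<alpha> + 1 - 1) / exp t)"
      using t by (simp add: powr_diff field_simps)
    finally show "norm (t powr \<alpha> / sinh t) \<le> norm (t powr (\<alpha> - 1) / exp t + 2 * (t powr (\<alpha> + 1 - 1) / exp t))"
      using t by simp
  qed
qed

text \<open>Positivity makes the limit in the lower bound for the type nonzero. If the integral were
  zero, the nonnegative integrand would vanish almost everywhere, although it is positive on
  \<open>(0, 1)\<close>.\<close>

lemma C_const_pos:
  assumes "\<alpha> > 0"
  shows "C_const \<alpha> > 0"
proof -
  have "set_lebesgue_integral lborel {0<..} (\<lambda>t. t powr \<alpha> / sinh t) \<noteq> 0"
  proof
    assume "set_lebesgue_integral lborel {0<..} (\<lambda>t. t powr \<alpha> / sinh t) = 0"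
    then have "AE t in lborel. indicator {0<..} t *\<^sub>R (t powr \<alpha> / sinh t) = 0"
      using set_integrable_powr_over_sinh[OF assms]
      unfolding set_lebesgue_integral_def set_integrable_def
      by (subst (asm) integral_nonneg_eq_0_iff_AE) (auto simp: indicator_def)
    then have "AE t in lborel. t \<notin> {0<..<(1::real)}"
      by eventually_elim (auto simp: indicator_def)
    then have "emeasure lborel {0<..<(1::real)} = 0"
      by (subst (asm) AE_iff_measurable[of "{0<..<1}"]) auto
    then show False by simp
  qed
  moreover have "set_lebesgue_integral lborel {0<..} (\<lambda>t. t powr \<alpha> / sinh t) \<ge> 0"
    unfolding set_lebesgue_integral_def by (intro integral_nonneg_AE) (auto simp: indicator_def)
  ultimately show ?thesis by (simp add: C_const_def)
qed

lemma H_fun_plus_2: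
  fixes \<gamma> x :: real
  assumes \<gamma>: "\<gamma> > 0" and x: "x > 0"
  shows "H_fun (\<gamma> + 2) x = x\<^sup>2 * H_fun \<gamma> x + 2 / pi * sin (pi * \<gamma> / 2) * C_const \<gamma> * x * sin x"
proof -
  let ?g = "\<lambda>t. t powr \<gamma> / sinh t"
  have int_g: "set_integrable lborel {0<..} ?g" by (rule set_integrable_powr_over_sinh[OF \<gamma>])
  have pos: "x\<^sup>2 + t\<^sup>2 > 0" for t using x by (simp add: add_pos_nonneg)
  have int_h: "set_integrable lborel {0<..} (\<lambda>t. ?g t * (x * sin x / (x\<^sup>2 + t\<^sup>2)))"
  proof (rule set_integrable_bound)
    show "set_integrable lborel {0<..} (\<lambda>t. (\<bar>x * sin x\<bar> / x\<^sup>2) * ?g t)"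
      by (intro set_integrable_mult_right int_g)
    show "set_borel_measurable lborel {0<..} (\<lambda>t. ?g t * (x * sin x / (x\<^sup>2 + t\<^sup>2)))"
      unfolding set_borel_measurable_def by measurable
    show "AE t in lborel. t \<in> {0<..} \<longrightarrow> norm (?g t * (x * sin x / (x\<^sup>2 + t\<^sup>2)))
            \<le> norm ((\<bar>x * sin x\<bar> / x\<^sup>2) * ?g t)"
    proof (intro AE_I2 impI)
      fix t :: real assume "t \<in> {0<..}"
      have "\<bar>x * sin x\<bar> / (x\<^sup>2 + t\<^sup>2) \<le> \<bar>x * sin x\<bar> / x\<^sup>2"
        using x pos[of t] by (intro divide_left_mono) auto
      then have "\<bar>?g t\<bar> * (\<bar>x * sin x\<bar> / (x\<^sup>2 + t\<^sup>2)) \<le> \<bar>?g t\<bar> * (\<bar>x * sin x\<bar> / x\<^sup>2)"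
        by (rule mult_left_mono) simp
      then show "norm (?g t * (x * sin x / (x\<^sup>2 + t\<^sup>2))) \<le> norm ((\<bar>x * sin x\<bar> / x\<^sup>2) * ?g t)"
        using pos[of t] by (simp add: abs_mult mult_ac)
    qed
  qed
  have "H_int (\<gamma> + 2) x = set_lebesgue_integral lborel {0<..}
          (\<lambda>t. x * sin x * ?g t - x\<^sup>2 * (?g t * (x * sin x / (x\<^sup>2 + t\<^sup>2))))"
    unfolding H_int_def using x
  proof (simp only: if_False less_imp_neq[symmetric], intro set_lebesgue_integral_cong ballI allI impI)
    fix t :: real assume "t \<in> {0<..}"
    then have t: "t > 0" by simp
    have "p * t\<^sup>2 * (q / (x\<^sup>2 + t\<^sup>2)) = q * p - x\<^sup>2 * (p * (q / (x\<^sup>2 + t\<^sup>2)))" for p q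
    proof -
      have "p * t\<^sup>2 * (q / w) = q * p - x\<^sup>2 * (p * (q / w))" if "w \<noteq> 0" "w = x\<^sup>2 + t\<^sup>2" for w
        using that(1) by (simp add: field_simps) (simp add: that(2) algebra_simps)
      from this[OF less_imp_neq[OF pos, symmetric] refl] show ?thesis .
    qed
    moreover have "t powr (\<gamma> + 2) / sinh t = ?g t * t\<^sup>2"
      using t by (simp add: powr_add)
    ultimately show "t powr (\<gamma> + 2) / sinh t * (x * sin x / (x\<^sup>2 + t\<^sup>2))
        = x * sin x * ?g t - x\<^sup>2 * (?g t * (x * sin x / (x\<^sup>2 + t\<^sup>2)))"
      by (simp only:)
  qed simp
  also have "\<dots> = x * sin x * C_const \<gamma> - x\<^sup>2 * H_int \<gamma> x"
    unfolding C_const_def H_int_def using x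
    by (subst set_integral_diff(2)[OF set_integrable_mult_right[OF int_g] set_integrable_mult_right[OF int_h]])
       (simp only: set_integral_mult_right if_False less_imp_neq[symmetric])
  finally have 1: "H_int (\<gamma> + 2) x = x * sin x * C_const \<gamma> - x\<^sup>2 * H_int \<gamma> x" .
  \<comment> \<open>This sign change lets \<open>- x^2 * H_int \<gamma> x\<close> recombine with the
    power term into \<open>x^2 * H_fun \<gamma> x\<close>.\<close>
  have 2: "sin (pi * (\<gamma> + 2) / 2) = - sin (pi * \<gamma> / 2)"
    using sin_periodic_pi[of "pi * \<gamma> / 2"] by (simp add: distrib_left add_divide_distrib)
  have 3: "\<bar>x\<bar> powr (\<gamma> + 2) = \<bar>x\<bar> powr \<gamma> * x\<^sup>2" using x by (simp add: powr_add)
  show ?thesis unfolding H_fun_def 1 2 3 by (simp add: algebra_simps)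
qed

lemma H_fun_plus_even:
  fixes \<beta> x :: real
  assumes \<beta>: "\<beta> > 0" and x: "x > 0"
  shows "H_fun (\<beta> + 2 * real N) x =
    sin x * (2 / pi * (\<Sum>n<N. sin (pi * (\<beta> + 2 * real N - 2 * real n - 2) / 2)
       * C_const (\<beta> + 2 * real N - 2 * real n - 2) * x ^ (2 * n + 1))) + x ^ (2 * N) * H_fun \<beta> x"
proof (induction N)
  case (Suc N)
  let ?s = "\<lambda>N n. sin (pi * (\<beta> + 2 * real N - 2 * real n - 2) / 2) * C_const (\<beta> + 2 * real N - 2 * real n - 2) * x ^ (2 * n + 1)"
  have eq: "\<beta> + 2 * real (Suc N) = (\<beta> + 2 * real N) + 2" by simp
  have "H_fun (\<beta> + 2 * real (Suc N)) x = x\<^sup>2 * H_fun (\<beta> + 2 * real N) x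
      + 2 / pi * sin (pi * (\<beta> + 2 * real N) / 2) * C_const (\<beta> + 2 * real N) * x * sin x"
    unfolding eq by (rule H_fun_plus_2) (use \<beta> x in auto)
  \<comment> \<open>The new summand is the one with \<open>n = 0\<close>. Sine and constant depend
    only on \<open>N - n\<close>, so the summand at \<open>Suc n\<close> is the old one at
    \<open>n\<close> times \<open>x^2\<close>.\<close>
  moreover have "(\<Sum>n<Suc N. ?s (Suc N) n) = sin (pi * (\<beta> + 2 * real N) / 2) * C_const (\<beta> + 2 * real N) * x
      + x\<^sup>2 * (\<Sum>n<N. ?s N n)"
    unfolding sum.lessThan_Suc_shift sum_distrib_left
    by (intro arg_cong2[where f = "(+)"] sum.cong refl) (simp_all add: power2_eq_square algebra_simps)
  ultimately show ?case
    unfolding Suc.IH by (simp only:) (simp add: power2_eq_square algebra_simps)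
qed simp

section \<open>Series of shifted sinc functions\<close>

definition csinc :: "complex \<Rightarrow> complex" where
  "csinc z = (if z = 0 then 1 else sin z / z)"

text \<open>\<open>csinc\<close> is the difference quotient of the sine at 0, extended over its
  removable singularity.\<close>

lemma holomorphic_csinc: "csinc holomorphic_on UNIV"
proof -
  have "(\<lambda>z. if z = 0 then deriv sin 0 else (sin z - sin 0) / (z - 0 :: complex)) holomorphic_on UNIV"
    by (rule pole_lemma_open) (auto intro: holomorphic_intros)
  also have "(\<lambda>z. if z = 0 then deriv sin 0 else (sin z - sin 0) / (z - 0 :: complex)) = csinc"
    by (auto simp: fun_eq_iff csinc_def intro!: DERIV_imp_deriv derivative_eq_intros)
  finally show ?thesis .
qed

lemma holomorphic_csinc' [holomorphic_intros]:
  "f holomorphic_on A \<Longrightarrow> (\<lambda>z. csinc (f z)) holomorphic_on A"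
  using holomorphic_on_compose_gen[of f A csinc UNIV] holomorphic_csinc by (simp add: o_def)

lemma norm_sin_cos_le_exp_Im:
  fixes z :: complex
  shows "norm (sin z) \<le> exp \<bar>Im z\<bar>" "norm (cos z) \<le> exp \<bar>Im z\<bar>"
proof -
  have n: "norm (exp (\<i> * z)) \<le> exp \<bar>Im z\<bar>" "norm (exp (- (\<i> * z))) \<le> exp \<bar>Im z\<bar>"
    by simp_all
  have "norm (exp (\<i> * z) - exp (- (\<i> * z))) \<le> 2 * exp \<bar>Im z\<bar>"
    "norm (exp (\<i> * z) + exp (- (\<i> * z))) \<le> 2 * exp \<bar>Im z\<bar>"
    using n norm_triangle_ineq4[of "exp (\<i> * z)" "exp (- (\<i> * z))"]
      norm_triangle_ineq[of "exp (\<i> * z)" "exp (- (\<i> * z))"] by linarith+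
  then show "norm (sin z) \<le> exp \<bar>Im z\<bar>" "norm (cos z) \<le> exp \<bar>Im z\<bar>"
    by (simp_all add: sin_exp_eq cos_exp_eq norm_divide norm_mult)
qed

text \<open>The mean value inequality on the convex strip of height \<open>\<bar>Im z\<bar>\<close>, where the derivative
  of the sine is bounded.\<close>

lemma norm_csinc_le: "norm (csinc z) \<le> exp \<bar>Im z\<bar>"
proof (cases "z = 0")
  case False
  define S where "S = {w. \<bar>Im w\<bar> \<le> \<bar>Im z\<bar>}"
  have "S = {w. Im w \<le> \<bar>Im z\<bar>} \<inter> {w. Im w \<ge> - \<bar>Im z\<bar>}" by (auto simp: S_def)
  then have "convex S" by (simp add: convex_Int convex_halfspace_Im_le convex_halfspace_Im_ge)
  then have "norm (sin z - sin 0) \<le> exp \<bar>Im z\<bar> * norm (z - 0)"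
  proof (rule field_differentiable_bound)
    show "(sin has_field_derivative cos w) (at w within S)" for w :: complex
      by (auto intro!: derivative_eq_intros)
    show "norm (cos w) \<le> exp \<bar>Im z\<bar>" if "w \<in> S" for w
      using norm_sin_cos_le_exp_Im(2)[of w] that by (auto simp: S_def intro: order_trans)
  qed (auto simp: S_def)
  then show ?thesis using False by (simp add: csinc_def norm_divide divide_le_eq)
qed (simp add: csinc_def)

text \<open>The entire form of sin z times the sum of
  \<open>(-1)^k * w_k * a_k / (z^2 - a_k^2)\<close> with \<open>a_k = k * pi\<close>,
  \<open>k \<ge> 1\<close>, where \<open>w_k\<close> stands for \<open>w (k - 1)\<close>: each pair
  of simple poles has been absorbed into two shifted sinc functions.\<close>

definition sinc_series :: "(nat \<Rightarrow> real) \<Rightarrow> complex \<Rightarrow> complex" where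
  "sinc_series w z = (\<Sum>k. of_real (w k / 2) *
     (csinc (z - of_real (real (Suc k) * pi)) - csinc (z + of_real (real (Suc k) * pi))))"

text \<open>Real shifts leave \<open>Im z\<close> unchanged, so the bound is uniform in
  \<open>a\<close>.\<close>

lemma norm_sinc_series_term_le:
  assumes "c \<ge> 0"
  shows "norm (of_real (c / 2) * (csinc (z - of_real a) - csinc (z + of_real a))) \<le> c * exp \<bar>Im z\<bar>"
proof -
  have "norm (csinc (z - of_real a) - csinc (z + of_real a)) \<le> 2 * exp \<bar>Im z\<bar>"
    using norm_triangle_ineq4[of "csinc (z - of_real a)" "csinc (z + of_real a)"]
      norm_csinc_le[of "z - of_real a"] norm_csinc_le[of "z + of_real a"] by simp
  then have "c / 2 * norm (csinc (z - of_real a) - csinc (z + of_real a)) \<le> c / 2 * (2 * exp \<bar>Im z\<bar>)"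
    using assms by (intro mult_left_mono) auto
  then show ?thesis using assms by (simp add: norm_mult)
qed

context
  fixes w :: "nat \<Rightarrow> real"
  assumes w_nonneg: "\<And>k. w k \<ge> 0" and w_summable: "summable w"
begin

lemma summable_sinc_series:
  "summable (\<lambda>k. of_real (w k / 2) *
     (csinc (z - of_real (real (Suc k) * pi)) - csinc (z + of_real (real (Suc k) * pi))))"
  using norm_sinc_series_term_le[OF w_nonneg]
  by (intro summable_comparison_test'[OF summable_mult2[OF w_summable, of "exp \<bar>Im z\<bar>"], of 0])

lemma norm_sinc_series_le: "norm (sinc_series w z) \<le> suminf w * exp \<bar>Im z\<bar>"
  unfolding sinc_series_def suminf_mult2[OF w_summable]
  using norm_sinc_series_term_le[OF w_nonneg]
  by (intro norm_suminf_le summable_mult2 w_summable)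

text \<open>Weierstrass M-test on unit balls, on which \<open>\<bar>Im z\<bar>\<close> exceeds its
  value at the centre by at most 1.\<close>

lemma holomorphic_sinc_series: "sinc_series w holomorphic_on UNIV"
proof (rule holomorphic_uniform_sequence)
  let ?f = "\<lambda>k z. of_real (w k / 2) *
     (csinc (z - of_real (real (Suc k) * pi)) - csinc (z + of_real (real (Suc k) * pi)))"
  show "(\<lambda>z. \<Sum>k<n. ?f k z) holomorphic_on UNIV" for n
    by (intro holomorphic_intros)
  show "\<exists>d>0. cball x d \<subseteq> UNIV \<and>
      uniform_limit (cball x d) (\<lambda>n z. \<Sum>k<n. ?f k z) (sinc_series w) sequentially" for x
  proof (intro exI[of _ 1] conjI)
    have "uniform_limit (cball x 1) (\<lambda>n z. \<Sum>k<n. ?f k z) (\<lambda>z. \<Sum>k. ?f k z) sequentially"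
    proof (rule Weierstrass_m_test)
      fix k z assume "z \<in> cball x 1"
      then have "\<bar>Im z\<bar> \<le> \<bar>Im x\<bar> + 1"
        using abs_Im_le_cmod[of "x - z"] by (auto simp: dist_norm)
      then have "w k * exp \<bar>Im z\<bar> \<le> w k * exp (\<bar>Im x\<bar> + 1)"
        by (intro mult_left_mono w_nonneg) simp
      then show "norm (?f k z) \<le> w k * exp (\<bar>Im x\<bar> + 1)"
        using norm_sinc_series_term_le[OF w_nonneg, of k z "real (Suc k) * pi"] by linarith
    qed (intro summable_mult2 w_summable)
    then show "uniform_limit (cball x 1) (\<lambda>n z. \<Sum>k<n. ?f k z) (sinc_series w) sequentially"
      by (simp only: sinc_series_def[abs_def])
  qed auto
qed auto

end

lemma csinc_of_real_diff:
  fixes x :: real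
  assumes "x \<noteq> real m * pi" "x \<noteq> - (real m * pi)"
  shows "csinc (of_real x - of_real (real m * pi)) - csinc (of_real x + of_real (real m * pi))
    = of_real ((-1) ^ m * sin x * (2 * (real m * pi) / (x\<^sup>2 - (real m * pi)\<^sup>2)))"
proof -
  define a where "a = real m * pi"
  have ne: "x - a \<noteq> 0" "x + a \<noteq> 0" using assms by (auto simp: a_def add_eq_0_iff2)
  have c: "csinc (of_real y) = of_real (sin y / y)" if "y \<noteq> 0" for y :: real
    using that by (simp add: csinc_def sin_of_real)
  have "sin (x - a) = (-1) ^ m * sin x" "sin (x + a) = (-1) ^ m * sin x"
    by (simp_all add: sin_diff sin_add a_def sin_npi cos_npi mult.commute)
  then have "csinc (of_real (x - a)) - csinc (of_real (x + a)) 
     = of_real ((-1) ^ m * sin x * (1 / (x - a) - 1 / (x + a)))"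
    unfolding c[OF ne(1)] c[OF ne(2)] of_real_diff[symmetric] of_real_eq_iff by (simp add: right_diff_distrib)
  also have "1 / (x - a) - 1 / (x + a) = 2 * a / ((x - a) * (x + a))"
    using ne by (simp add: diff_frac_eq)
  also have "(x - a) * (x + a) = x\<^sup>2 - a\<^sup>2" by (simp add: power2_eq_square algebra_simps)
  finally show ?thesis unfolding a_def of_real_diff of_real_add .
qed

section \<open>The entire extension\<close>

lemma summable_shifted_pi_powr:
  fixes s :: real
  assumes "s < -1"
  shows "summable (\<lambda>k. (real (Suc k) * pi) powr s)"
proof -
  have "summable (\<lambda>k. real k powr s)" using assms by (simp add: summable_real_powr_iff)
  then have "summable (\<lambda>k. real (Suc k) powr s * pi powr s)"
    by (intro summable_mult2) (simp only: summable_Suc_iff[of "\<lambda>k. real k powr s"])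
  then show ?thesis by (simp only: powr_mult)
qed

text \<open>Leibniz criterion; for \<open>s \<ge> -1\<close> the convergence is not
  absolute.\<close>

lemma summable_alternating_pi_powr:
  fixes s :: real
  assumes "s < 0"
  shows "summable (\<lambda>k. (-1) ^ Suc k * (real (Suc k) * pi) powr s)"
proof -
  define f where "f = (\<lambda>k. (real (Suc k) * pi) powr s)"
  have "f \<longlonglongrightarrow> 0"
    unfolding f_def using assms
    by (intro tendsto_neg_powr filterlim_at_top_mult_tendsto_pos[OF tendsto_const]
          filterlim_compose[OF filterlim_real_sequentially filterlim_Suc]) auto
  moreover have "decseq f"
    unfolding f_def decseq_Suc_iff using assms
    by (auto intro!: powr_mono2' mult_right_mono)
  ultimately have "summable (\<lambda>k. (-1) ^ k * f k)"
    by (intro summable_Leibniz(1)) (auto simp: monoseq_iff)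
  from summable_minus[OF this] show ?thesis by (simp add: f_def)
qed

lemma not_in_poles: "x \<notin> poles \<Longrightarrow> x \<noteq> real (Suc k) * pi \<and> x \<noteq> - (real (Suc k) * pi)"
  unfolding poles_def by (metis (mono_tags, lifting) One_nat_def Suc_le_mono le0 mem_Collect_eq)

lemma sin_eq_0_not_in_poles:
  assumes "x \<notin> poles" "sin x = 0"
  shows "x = 0"
proof (rule ccontr)
  assume "x \<noteq> 0"
  obtain i :: int where i: "x = of_int i * pi" using assms(2) sin_zero_iff_int2 by blast
  have "1 \<le> nat \<bar>i\<bar>" using i \<open>x \<noteq> 0\<close> by auto
  moreover have "x = real (nat \<bar>i\<bar>) * pi \<or> x = - (real (nat \<bar>i\<bar>) * pi)"
    using i by (cases "i \<ge> 0") auto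
  ultimately have "x \<in> poles" unfolding poles_def by blast
  with assms(1) show False by contradiction
qed

context
  fixes \<beta> :: real
  assumes \<beta>: "0 < \<beta>" "\<beta> < 2"
begin

text \<open>Writing \<open>a\<^sup>2 / (x\<^sup>2 - a\<^sup>2) = x\<^sup>2 / (x\<^sup>2 - a\<^sup>2) - 1\<close> splits the conditionally convergent pole series
  into an alternating constant and an absolutely convergent series.\<close>

lemma sin_times_series_term_sums:
  assumes x: "x \<notin> poles"
  shows "(\<lambda>k. complex_of_real (sin x * series_term \<beta> x (Suc k))) sums
     (of_real (x\<^sup>2) * sinc_series (\<lambda>k. (real (Suc k) * pi) powr (\<beta> - 3)) (of_real x)
       - of_real (sin x * (\<Sum>k. (-1) ^ Suc k * (real (Suc k) * pi) powr (\<beta> - 2))))"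
proof -
  define a where "a = (\<lambda>k. real (Suc k) * pi)"
  define e where "e = (\<lambda>k. complex_of_real (a k powr (\<beta> - 3) / 2)
     * (csinc (of_real x - of_real (a k)) - csinc (of_real x + of_real (a k))))"
  \<comment> \<open>The difference of sinc functions contributes a factor \<open>a k\<close>, so the
    weight has exponent \<open>\<beta> - 3\<close> to produce \<open>a k powr (\<beta> - 2)\<close>;
    it is summable because \<open>\<beta> - 3 < -1\<close>.\<close>
  have e_sums: "e sums sinc_series (\<lambda>k. a k powr (\<beta> - 3)) (of_real x)"
    unfolding e_def a_def sinc_series_def
    using \<beta> by (intro summable_sums summable_sinc_series summable_shifted_pi_powr) auto
  have k_sums: "(\<lambda>k. (-1) ^ Suc k * a k powr (\<beta> - 2)) sums (\<Sum>k. (-1) ^ Suc k * a k powr (\<beta> - 2))"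
    unfolding a_def using \<beta> by (intro summable_sums summable_alternating_pi_powr) auto
  have "(\<lambda>k. of_real (x\<^sup>2) * e k - of_real (sin x * ((-1) ^ Suc k * a k powr (\<beta> - 2))))
     sums (of_real (x\<^sup>2) * sinc_series (\<lambda>k. a k powr (\<beta> - 3)) (of_real x)
       - of_real (sin x * (\<Sum>k. (-1) ^ Suc k * a k powr (\<beta> - 2))))"
    by (intro sums_diff sums_mult e_sums sums_of_real k_sums)
  moreover have "of_real (x\<^sup>2) * e k - of_real (sin x * ((-1) ^ Suc k * a k powr (\<beta> - 2)))
      = complex_of_real (sin x * series_term \<beta> x (Suc k))" for k
  proof -
    define c where "c = (-1::real) ^ Suc k"
    define d where "d = x\<^sup>2 - (a k)\<^sup>2"
    have ak: "a k > 0" by (simp add: a_def)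
    have "x \<noteq> a k" "x \<noteq> - a k" using not_in_poles[OF x] by (auto simp: a_def)
    then have d: "d \<noteq> 0" unfolding d_def by (simp add: power2_eq_iff)
    have "csinc (of_real x - of_real (a k)) - csinc (of_real x + of_real (a k))
       = of_real (c * sin x * (2 * a k / d))"
      unfolding c_def d_def a_def
      by (rule csinc_of_real_diff) (use not_in_poles[OF x] in auto)
    then have "e k = of_real (a k powr (\<beta> - 3) / 2 * (c * sin x * (2 * a k / d)))"
      unfolding e_def by (simp only: of_real_mult)
    moreover have "x\<^sup>2 * (a k powr (\<beta> - 3) / 2 * (c * sin x * (2 * a k / d))) - sin x * (c * a k powr (\<beta> - 2))
       = sin x * series_term \<beta> x (Suc k)"
    proof -
      have 1: "a k powr (\<beta> - 2) = a k powr (\<beta> - 3) * a k"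
        using ak by (simp add: powr_diff power2_eq_square power3_eq_cube)
      have 2: "a k powr \<beta> = a k powr (\<beta> - 2) * (x\<^sup>2 - d)"
        using ak by (simp add: d_def powr_diff)
      have 3: "series_term \<beta> x (Suc k) = c * (a k powr \<beta> / d)"
        unfolding series_term_def c_def d_def a_def ..
      show ?thesis
        unfolding 3 2 1 using d by (simp add: field_simps)
    qed
    ultimately show ?thesis
      unfolding c_def by (simp only: of_real_mult[symmetric] of_real_diff[symmetric])
  qed
  ultimately show ?thesis unfolding a_def by (simp only:)
qed

text \<open>Off the poles the sine vanishes only at 0. Elsewhere it can be divided out of the
  previous series; at 0 the series is itself an alternating one.\<close>

lemma summable_series_term:
  assumes x: "x \<notin> poles"
  shows "summable (\<lambda>k. series_term \<beta> x (Suc k))"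
proof (cases "x = 0")
  case False
  then have "sin x \<noteq> 0" using sin_eq_0_not_in_poles x by blast
  moreover have "summable (\<lambda>k. sin x * series_term \<beta> x (Suc k))"
    using sin_times_series_term_sums[OF x] sums_summable summable_of_real_iff by blast
  ultimately show ?thesis by (simp add: summable_cmult_iff)
next
  case True
  have "summable (\<lambda>k. - ((-1) ^ Suc k * (real (Suc k) * pi) powr (\<beta> - 2)))"
    using \<beta> by (intro summable_minus summable_alternating_pi_powr) auto
  moreover have "series_term \<beta> 0 (Suc k) = - ((-1) ^ Suc k * (real (Suc k) * pi) powr (\<beta> - 2))" for k
    by (simp add: series_term_def powr_diff)
  ultimately show ?thesis by (simp add: True)
qed

lemma sin_times_pole_series:
  assumes x: "x \<notin> poles"
  shows "complex_of_real (sin x * pole_series \<beta> x) =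
     of_real (x\<^sup>2) * sinc_series (\<lambda>k. (real (Suc k) * pi) powr (\<beta> - 3)) (of_real x)
       - of_real (sin x * (\<Sum>k. (-1) ^ Suc k * (real (Suc k) * pi) powr (\<beta> - 2)))"
proof -
  have "(\<lambda>k. complex_of_real (sin x * series_term \<beta> x (Suc k))) sums complex_of_real (sin x * pole_series \<beta> x)"
    unfolding pole_series_def
    by (intro sums_of_real sums_mult summable_sums summable_series_term x)
  then show ?thesis using sin_times_series_term_sums[OF x] sums_unique2 by blast
qed

end

text \<open>The claimed expansion with \<open>sin x * pole_series\<close> replaced by its entire
  form from \<open>sin_times_pole_series\<close>: the alternating constant joins the polynomial
  part, and the factor \<open>x^2\<close> raises the last power to \<open>2 * N + 3\<close>.\<close>

definition H_ext :: "real \<Rightarrow> nat \<Rightarrow> complex \<Rightarrow> complex" where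
  "H_ext \<alpha> N z =
     sin z * (of_real (2 / pi) * (\<Sum>n<N. of_real (sin (pi * (\<alpha> - 2 * real n - 2) / 2)
         * C_const (\<alpha> - 2 * real n - 2)) * z ^ (2 * n + 1))
       - of_real (2 * (\<Sum>k. (-1) ^ Suc k * (real (Suc k) * pi) powr (\<alpha> - 2 * real N - 2))) * z ^ (2 * N + 1))
     + 2 * z ^ (2 * N + 3) * sinc_series (\<lambda>k. (real (Suc k) * pi) powr (\<alpha> - 2 * real N - 3)) z"

context
  fixes \<alpha> :: real and N :: nat
  assumes \<alpha>N: "0 < \<alpha> - 2 * real N" "\<alpha> - 2 * real N < 2"
begin

lemma summable_H_ext_weights: "summable (\<lambda>k. (real (Suc k) * pi) powr (\<alpha> - 2 * real N - 3))"
  using \<alpha>N by (intro summable_shifted_pi_powr) auto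

lemma holomorphic_H_ext: "H_ext \<alpha> N holomorphic_on UNIV"
  unfolding H_ext_def[abs_def]
  by (intro holomorphic_intros holomorphic_sinc_series summable_H_ext_weights) auto

lemma H_ext_eq_series:
  assumes x: "x \<notin> poles"
  shows "H_ext \<alpha> N (of_real x) = of_real (sin x *
          (2 / pi * (\<Sum>n<N. sin (pi * (\<alpha> - 2 * real n - 2) / 2)
                               * C_const (\<alpha> - 2 * real n - 2) * x ^ (2 * n + 1))
           + 2 * x ^ (2 * N + 1) * pole_series (\<alpha> - 2 * real N) x))"
proof -
  define P where "P = 2 / pi * (\<Sum>n<N. sin (pi * (\<alpha> - 2 * real n - 2) / 2)
                               * C_const (\<alpha> - 2 * real n - 2) * x ^ (2 * n + 1))"
  define K where "K = (\<Sum>k. (-1) ^ Suc k * (real (Suc k) * pi) powr (\<alpha> - 2 * real N - 2))"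
  define E where "E = sinc_series (\<lambda>k. (real (Suc k) * pi) powr (\<alpha> - 2 * real N - 3)) (of_real x)"
  have P: "of_real (2 / pi) * (\<Sum>n<N. complex_of_real (sin (pi * (\<alpha> - 2 * real n - 2) / 2)
         * C_const (\<alpha> - 2 * real n - 2)) * of_real x ^ (2 * n + 1)) = of_real P"
    by (simp add: P_def)
  have "H_ext \<alpha> N (of_real x) = of_real (sin x) * (of_real P - of_real (2 * K * x ^ (2 * N + 1)))
     + of_real (2 * x ^ (2 * N + 1)) * (of_real (x\<^sup>2) * E)"
    unfolding H_ext_def P K_def[symmetric] E_def[symmetric] sin_of_real
    by (simp add: power2_eq_square power3_eq_cube power_add mult_ac)
  also have "of_real (x\<^sup>2) * E = of_real (sin x * pole_series (\<alpha> - 2 * real N) x) + of_real (sin x * K)"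
    unfolding E_def K_def sin_times_pole_series[OF \<alpha>N x] by simp
  also have "of_real (sin x) * (of_real P - of_real (2 * K * x ^ (2 * N + 1))) + of_real (2 * x ^ (2 * N + 1)) *
        (of_real (sin x * pole_series (\<alpha> - 2 * real N) x) + of_real (sin x * K))
     = complex_of_real (sin x * (P + 2 * x ^ (2 * N + 1) * pole_series (\<alpha> - 2 * real N) x))"
    by (simp add: algebra_simps)
  finally show ?thesis unfolding P_def .
qed

text \<open>The seed for the analytic continuation: the reduction of the exponent applied to
  \<open>\<beta> = \<alpha> - 2 * real N\<close>, combined with the pole series for
  \<open>\<beta>\<close>.\<close>

lemma H_ext_eq_H_fun_near_0:
  assumes x: "0 < x" "x < pi"
  shows "H_ext \<alpha> N (of_real x) = of_real (H_fun \<alpha> x)"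
proof -
  have "x \<notin> poles"
  proof
    assume "x \<in> poles"
    then obtain k :: nat where "1 \<le> k" "x = real k * pi \<or> x = - (real k * pi)"
      unfolding poles_def by auto
    moreover from this have "pi \<le> real k * pi" by simp
    ultimately show False using x by linarith
  qed
  from H_ext_eq_series[OF this] show ?thesis
    using H_fun_plus_even[OF \<alpha>N(1) x(1), of N] H_fun_pole_series[OF \<alpha>N x]
    by (simp add: algebra_simps)
qed

text \<open>The sine and the sinc series are at most a constant times
  \<open>exp \<bar>Im z\<bar>\<close>, and all powers of \<open>z\<close> that occur are at most
  \<open>(1 + norm z) ^ (2 * N + 3)\<close>.\<close>

lemma H_ext_growth:
  obtains B where "B > 0" "\<And>z. norm (H_ext \<alpha> N z) \<le> B * (1 + norm z) ^ (2 * N + 3) * exp (norm z)"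
proof -
  define c where "c = (\<lambda>n. norm (complex_of_real (sin (pi * (\<alpha> - 2 * real n - 2) / 2) * C_const (\<alpha> - 2 * real n - 2))))"
  define K where "K = complex_of_real (2 * (\<Sum>k. (-1) ^ Suc k * (real (Suc k) * pi) powr (\<alpha> - 2 * real N - 2)))"
  define W where "W = (\<Sum>k. (real (Suc k) * pi) powr (\<alpha> - 2 * real N - 3))"
  define B where "B = 2 / pi * (\<Sum>n<N. c n) + norm K + 2 * W"
  have W: "W \<ge> 0" unfolding W_def by (intro suminf_nonneg summable_H_ext_weights) auto
  have c: "c n \<ge> 0" for n by (simp add: c_def)
  have "norm (H_ext \<alpha> N z) \<le> (B + 1) * (1 + norm z) ^ (2 * N + 3) * exp (norm z)" for z
  proof -
    define R where "R = (1 + norm z) ^ (2 * N + 3)"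
    define X where "X = exp (norm z)"
    have pw: "norm z ^ m \<le> R" if "m \<le> 2 * N + 3" for m
    proof -
      have "norm z ^ m \<le> (1 + norm z) ^ m" by (intro power_mono) auto
      also have "\<dots> \<le> R" unfolding R_def using that by (intro power_increasing) auto
      finally show ?thesis .
    qed
    have X: "exp \<bar>Im z\<bar> \<le> X" "X \<ge> 0" using abs_Im_le_cmod by (auto simp: X_def)
    have R: "R \<ge> 0" by (simp add: R_def)
    have s: "norm (sin z) \<le> X" using norm_sin_cos_le_exp_Im(1) X(1) by (rule order_trans)
    have "norm (\<Sum>n<N. complex_of_real (sin (pi * (\<alpha> - 2 * real n - 2) / 2)
         * C_const (\<alpha> - 2 * real n - 2)) * z ^ (2 * n + 1)) \<le> (\<Sum>n<N. c n * R)"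
      by (intro sum_norm_le) (auto simp only: norm_mult norm_power c_def lessThan_iff intro!: mult_left_mono pw norm_ge_zero)
    then have p: "norm (of_real (2 / pi) * (\<Sum>n<N. complex_of_real (sin (pi * (\<alpha> - 2 * real n - 2) / 2)
         * C_const (\<alpha> - 2 * real n - 2)) * z ^ (2 * n + 1))) \<le> 2 / pi * (\<Sum>n<N. c n) * R"
      unfolding norm_mult sum_distrib_right[symmetric] norm_of_real by (simp add: divide_right_mono)
    have k: "norm (K * z ^ (2 * N + 1)) \<le> norm K * R"
      unfolding norm_mult norm_power by (intro mult_left_mono pw) auto
    have "norm (sin z * (of_real (2 / pi) * (\<Sum>n<N. complex_of_real (sin (pi * (\<alpha> - 2 * real n - 2) / 2)
         * C_const (\<alpha> - 2 * real n - 2)) * z ^ (2 * n + 1)) - K * z ^ (2 * N + 1)))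
        \<le> X * (2 / pi * (\<Sum>n<N. c n) * R + norm K * R)"
      unfolding norm_mult[of "sin z"]
      by (intro mult_mono s X order_trans[OF norm_triangle_ineq4 add_mono[OF p k]] norm_ge_zero)
    moreover have "norm (2 * z ^ (2 * N + 3) * sinc_series (\<lambda>k. (real (Suc k) * pi) powr (\<alpha> - 2 * real N - 3)) z)
        \<le> 2 * R * (W * X)"
    proof -
      have "norm (sinc_series (\<lambda>k. (real (Suc k) * pi) powr (\<alpha> - 2 * real N - 3)) z) \<le> W * exp \<bar>Im z\<bar>"
        unfolding W_def by (intro norm_sinc_series_le summable_H_ext_weights) auto
      also have "\<dots> \<le> W * X" by (intro mult_left_mono W X)
      finally show ?thesis
        unfolding norm_mult norm_power using R pw[of "2 * N + 3"] by (intro mult_mono) auto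
    qed
    ultimately have "norm (H_ext \<alpha> N z) \<le> X * (2 / pi * (\<Sum>n<N. c n) * R + norm K * R) + 2 * R * (W * X)"
      unfolding H_ext_def K_def by (rule norm_triangle_le[OF add_mono])
    also have "\<dots> = B * R * X" by (simp add: B_def algebra_simps)
    \<comment> \<open>The parts of \<open>B\<close> are known to be nonnegative; adding 1 makes the
      constant strictly positive.\<close>
    also have "\<dots> \<le> (B + 1) * R * X" using R X by (intro mult_right_mono) auto
    finally show ?thesis unfolding R_def X_def .
  qed
  moreover have "B + 1 > 0"
    unfolding B_def using W c by (intro add_nonneg_pos add_nonneg_nonneg mult_nonneg_nonneg sum_nonneg) auto
  ultimately show ?thesis using that by blast
qed

end

section \<open>Stieltjes transforms\<close>

text \<open>The argument \<open>w\<close> plays the role of \<open>x^2\<close>: with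
  \<open>g t = t powr \<alpha> / sinh t\<close>, the integral \<open>H_int \<alpha> x\<close> is
  \<open>x * sin x\<close> times the value at \<open>x^2\<close>.\<close>

definition stieltjes :: "(real \<Rightarrow> real) \<Rightarrow> complex \<Rightarrow> complex" where
  "stieltjes g w = set_lebesgue_integral lborel {0<..} (\<lambda>t. of_real (g t) / (w + of_real (t\<^sup>2)))"

lemma set_integrable_of_real_mult_bounded:
  fixes g :: "real \<Rightarrow> real" and f :: "real \<Rightarrow> complex"
  assumes g: "set_integrable lborel {0<..} g"
    and [measurable]: "g \<in> borel_measurable borel" "f \<in> borel_measurable borel"
    and le: "\<And>t. norm (f t) \<le> M"
  shows "set_integrable lborel {0<..} (\<lambda>t. of_real (g t) * f t)"
proof (rule set_integrable_bound)
  show "set_integrable lborel {0<..} (\<lambda>t. M * g t)" using g by (rule set_integrable_mult_right)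
  show "set_borel_measurable lborel {0<..} (\<lambda>t. of_real (g t) * f t)"
    unfolding set_borel_measurable_def by measurable
  have "M \<ge> 0" using le norm_ge_zero order_trans by blast
  then have "norm (of_real (g t) * f t) \<le> norm (M * g t)" for t
    using mult_right_mono[OF le[of t], of "\<bar>g t\<bar>"] by (simp add: norm_mult abs_mult mult.commute)
  then show "AE t in lborel. t \<in> {0<..} \<longrightarrow> norm (of_real (g t) * f t) \<le> norm (M * g t)"
    by simp
qed

text \<open>Dominated convergence for uniformly bounded kernels against a fixed density; it serves
  both the derivative and the limit along a ray.\<close>

lemma set_integral_of_real_mult_tendsto:
  fixes g :: "real \<Rightarrow> real" and f :: "nat \<Rightarrow> real \<Rightarrow> complex"
  assumes g: "set_integrable lborel {0<..} g"
    and [measurable]: "g \<in> borel_measurable borel" "\<And>n. f n \<in> borel_measurable borel" "f' \<in> borel_measurable borel"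
    and le: "\<And>n t. norm (f n t) \<le> M"
    and lim: "\<And>t. t > 0 \<Longrightarrow> (\<lambda>n. f n t) \<longlonglongrightarrow> f' t"
  shows "(\<lambda>n. set_lebesgue_integral lborel {0<..} (\<lambda>t. of_real (g t) * f n t))
           \<longlonglongrightarrow> set_lebesgue_integral lborel {0<..} (\<lambda>t. of_real (g t) * f' t)"
  unfolding set_lebesgue_integral_def
proof (rule integral_dominated_convergence)
  show "integrable lborel (\<lambda>t. M * \<bar>indicator {0<..} t *\<^sub>R g t\<bar>)"
    using g unfolding set_integrable_def by (intro integrable_mult_right integrable_abs)
  show "AE t in lborel. (\<lambda>n. indicator {0<..} t *\<^sub>R (of_real (g t) * f n t))
          \<longlonglongrightarrow> indicator {0<..} t *\<^sub>R (of_real (g t) * f' t)"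
    using lim by (auto simp: indicator_def intro!: tendsto_mult)
  show "AE t in lborel. norm (indicator {0<..} t *\<^sub>R (of_real (g t) * f n t))
          \<le> M * \<bar>indicator {0<..} t *\<^sub>R g t\<bar>" for n
    using mult_right_mono[OF le abs_ge_zero] by (auto simp: indicator_def norm_mult mult.commute)
qed measurable

text \<open>All points \<open>- t^2\<close> lie on the closed cut
  \<open>\<real>\<^sub>\<le>\<^sub>0\<close>, from which \<open>w\<close> has positive distance;
  half of such a distance works on a whole ball around \<open>w\<close>.\<close>

lemma stieltjes_kernel_lower_bound:
  fixes w :: complex
  assumes "w \<notin> \<real>\<^sub>\<le>\<^sub>0"
  obtains c where "c > 0" "\<And>v t. v \<in> ball w c \<Longrightarrow> c \<le> norm (v + of_real (t\<^sup>2))"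
proof -
  have "open (- (\<real>\<^sub>\<le>\<^sub>0 :: complex set))" by (simp add: closed_nonpos_Reals_complex open_Compl)
  moreover have "w \<in> - \<real>\<^sub>\<le>\<^sub>0" using assms by simp
  ultimately obtain e where e: "e > 0" "ball w e \<subseteq> - \<real>\<^sub>\<le>\<^sub>0" by (rule openE)
  have "e / 2 \<le> norm (v + of_real (t\<^sup>2))" if v: "v \<in> ball w (e / 2)" for v and t :: real
  proof -
    have "- complex_of_real (t\<^sup>2) \<in> \<real>\<^sub>\<le>\<^sub>0" by (simp add: complex_nonpos_Reals_iff)
    then have "- complex_of_real (t\<^sup>2) \<notin> ball w e" using e(2) by auto
    then have "e \<le> dist w (- of_real (t\<^sup>2))" by simp
    also have "\<dots> \<le> dist w v + dist v (- of_real (t\<^sup>2))" by (rule dist_triangle)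
    also have "dist w v < e / 2" using v by simp
    finally show ?thesis by (simp add: dist_norm)
  qed
  with e(1) show ?thesis by (intro that[of "e / 2"]) auto
qed

text \<open>The difference quotient of the kernel is exactly
  \<open>- 1 / ((v + t^2) * (w + t^2))\<close>, which is bounded near \<open>w\<close> uniformly in
  \<open>t\<close>; dominated convergence along sequences then permits differentiation under the
  integral.\<close>

lemma stieltjes_has_field_derivative:
  fixes g :: "real \<Rightarrow> real"
  assumes g: "set_integrable lborel {0<..} g" and [measurable]: "g \<in> borel_measurable borel"
    and w: "w \<notin> \<real>\<^sub>\<le>\<^sub>0"
  shows "(stieltjes g has_field_derivative
     set_lebesgue_integral lborel {0<..} (\<lambda>t. of_real (g t) * (- 1 / (w + of_real (t\<^sup>2))\<^sup>2))) (at w)"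
proof -
  obtain c where c: "c > 0" and le: "\<And>v t. v \<in> ball w c \<Longrightarrow> c \<le> norm (v + of_real (t\<^sup>2))"
    using stieltjes_kernel_lower_bound[OF w] by blast
  have nz: "v + of_real (t\<^sup>2) \<noteq> 0" if "v \<in> ball w c" for v and t :: real
    using le[OF that, of t] c by auto
  have wb: "w \<in> ball w c" using c by simp
  have int: "set_integrable lborel {0<..} (\<lambda>t. of_real (g t) * (1 / (v + of_real (t\<^sup>2))))"
    if "v \<in> ball w c" for v
  proof (rule set_integrable_of_real_mult_bounded[OF g, where M = "1 / c"])
    show "norm (1 / (v + of_real (t\<^sup>2))) \<le> 1 / c" for t :: real
      using le[OF that, of t] c by (simp add: norm_divide frac_le)
  qed measurable
  have quot: "(stieltjes g v - stieltjes g w) / (v - w) =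
      set_lebesgue_integral lborel {0<..} (\<lambda>t. of_real (g t) * (- 1 / ((v + of_real (t\<^sup>2)) * (w + of_real (t\<^sup>2)))))"
    if v: "v \<in> ball w c" "v \<noteq> w" for v
  proof -
    have "(stieltjes g v - stieltjes g w) / (v - w) = set_lebesgue_integral lborel {0<..}
       (\<lambda>t. (of_real (g t) * (1 / (v + of_real (t\<^sup>2))) - of_real (g t) * (1 / (w + of_real (t\<^sup>2)))) / (v - w))"
      unfolding stieltjes_def set_integral_divide_zero set_integral_diff(2)[OF int[OF v(1)] int[OF wb]] by simp
    also have "(\<lambda>t. (of_real (g t) * (1 / (v + of_real (t\<^sup>2))) - of_real (g t) * (1 / (w + of_real (t\<^sup>2)))) / (v - w))
        = (\<lambda>t. of_real (g t) * (- 1 / ((v + of_real (t\<^sup>2)) * (w + of_real (t\<^sup>2)))))"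
    proof
      fix t :: real
      have "(G * (1 / p) - G * (1 / q)) / (v - w) = G * (- 1 / (p * q))"
        if "p \<noteq> 0" "q \<noteq> 0" "v - w = p - q" for p q G :: complex
      proof -
        have "p - q \<noteq> 0" using that(3) v(2) by auto
        then show ?thesis unfolding that(3) using that(1,2) by (simp add: divide_simps) (simp add: algebra_simps)
      qed
      from this[OF nz[OF v(1)] nz[OF wb]]
      show "(of_real (g t) * (1 / (v + of_real (t\<^sup>2))) - of_real (g t) * (1 / (w + of_real (t\<^sup>2)))) / (v - w)
        = of_real (g t) * (- 1 / ((v + of_real (t\<^sup>2)) * (w + of_real (t\<^sup>2))))" by simp
    qed
    finally show ?thesis .
  qed
  have "((\<lambda>v. (stieltjes g v - stieltjes g w) / (v - w)) \<longlongrightarrow>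
     set_lebesgue_integral lborel {0<..} (\<lambda>t. of_real (g t) * (- 1 / (w + of_real (t\<^sup>2))\<^sup>2))) (at w within ball w c)"
    unfolding tendsto_at_iff_sequentially
  proof (intro allI impI)
    fix X :: "nat \<Rightarrow> complex"
    assume X: "\<forall>i. X i \<in> ball w c - {w}" and Xw: "X \<longlonglongrightarrow> w"
    have "(\<lambda>n. set_lebesgue_integral lborel {0<..} (\<lambda>t. of_real (g t) * (- 1 / ((X n + of_real (t\<^sup>2)) * (w + of_real (t\<^sup>2))))))
       \<longlonglongrightarrow> set_lebesgue_integral lborel {0<..} (\<lambda>t. of_real (g t) * (- 1 / (w + of_real (t\<^sup>2))\<^sup>2))"
    proof (rule set_integral_of_real_mult_tendsto[OF g, where M = "1 / (c * c)"])
      show "norm (- 1 / ((X n + of_real (t\<^sup>2)) * (w + of_real (t\<^sup>2)))) \<le> 1 / (c * c)" for n and t :: real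
      proof -
        have "c * c \<le> norm (X n + of_real (t\<^sup>2)) * norm (w + of_real (t\<^sup>2))"
          using X c wb by (intro mult_mono le) auto
        then show ?thesis using c by (simp add: norm_divide norm_mult frac_le)
      qed
      show "(\<lambda>n. - 1 / ((X n + of_real (t\<^sup>2)) * (w + of_real (t\<^sup>2)))) \<longlonglongrightarrow> - 1 / (w + of_real (t\<^sup>2))\<^sup>2" for t :: real
        unfolding power2_eq_square[of "w + _"] using nz[OF wb, of t] by (intro tendsto_intros Xw) auto
    qed measurable
    then show "((\<lambda>v. (stieltjes g v - stieltjes g w) / (v - w)) \<circ> X) \<longlonglongrightarrow>
       set_lebesgue_integral lborel {0<..} (\<lambda>t. of_real (g t) * (- 1 / (w + of_real (t\<^sup>2))\<^sup>2))"
      using X by (simp add: o_def quot)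
  qed
  then show ?thesis
    unfolding has_field_derivative_iff using at_within_open[OF wb] by simp
qed

text \<open>The kernel \<open>z / (z + t^2)\<close> tends to 1 as \<open>z\<close> moves out along
  the ray. Dividing by the square of \<open>Suc n\<close> turns it into \<open>w / (w + s)\<close>
  with real \<open>s\<close>, bounded by \<open>norm w / \<bar>Im w\<bar>\<close>.\<close>

lemma stieltjes_tendsto_along_ray:
  fixes g :: "real \<Rightarrow> real"
  assumes g: "set_integrable lborel {0<..} g" and [measurable]: "g \<in> borel_measurable borel"
    and w: "Im w \<noteq> 0"
  shows "(\<lambda>n. (of_nat (Suc n))\<^sup>2 * w * stieltjes g ((of_nat (Suc n))\<^sup>2 * w))
           \<longlonglongrightarrow> of_real (set_lebesgue_integral lborel {0<..} g)"
proof -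
  define z where "z = (\<lambda>n. (of_nat (Suc n))\<^sup>2 * w)"
  have Im: "\<bar>Im w\<bar> \<le> norm (w + of_real s)" for s using abs_Im_le_cmod[of "w + of_real s"] by simp
  have nz: "w + of_real s \<noteq> 0" for s using w by (auto simp: complex_eq_iff)
  have eq: "z n / (z n + of_real (t\<^sup>2)) = w / (w + of_real (t\<^sup>2 / (real (Suc n))\<^sup>2))" for n t
  proof -
    define m where "m = complex_of_nat (Suc n)"
    have m: "m \<noteq> 0" by (simp add: m_def del: of_nat_Suc)
    have "w + of_real (t\<^sup>2 / (real (Suc n))\<^sup>2) = (z n + of_real (t\<^sup>2)) / m\<^sup>2"
      using m by (simp add: z_def m_def[symmetric] add_divide_distrib of_real_divide del: of_nat_Suc)
    then show ?thesis using m by (simp add: z_def m_def[symmetric] del: of_nat_Suc)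
  qed
  have "(\<lambda>n. set_lebesgue_integral lborel {0<..} (\<lambda>t. of_real (g t) * (z n / (z n + of_real (t\<^sup>2)))))
     \<longlonglongrightarrow> set_lebesgue_integral lborel {0<..} (\<lambda>t. of_real (g t) * 1)"
  proof (rule set_integral_of_real_mult_tendsto[OF g, where M = "norm w / \<bar>Im w\<bar>"])
    show "norm (z n / (z n + of_real (t\<^sup>2))) \<le> norm w / \<bar>Im w\<bar>" for n t
      unfolding eq norm_divide using w
      by (intro divide_left_mono Im mult_pos_pos) (auto simp only: zero_less_norm_iff zero_less_abs_iff nz norm_ge_zero)
    show "(\<lambda>n. z n / (z n + of_real (t\<^sup>2))) \<longlonglongrightarrow> 1" for t
    proof -
      have "(\<lambda>n. t\<^sup>2 / (real (Suc n))\<^sup>2) \<longlonglongrightarrow> 0" by real_asymp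
      then have "(\<lambda>n. w / (w + of_real (t\<^sup>2 / (real (Suc n))\<^sup>2))) \<longlonglongrightarrow> w / (w + of_real 0)"
        using w by (intro tendsto_intros) auto
      moreover have "w \<noteq> 0" using w by auto
      ultimately show ?thesis unfolding eq by simp
    qed
  qed measurable
  moreover have "set_lebesgue_integral lborel {0<..} (\<lambda>t. of_real (g t) * (z n / (z n + of_real (t\<^sup>2))))
     = z n * stieltjes g (z n)" for n
    unfolding stieltjes_def set_integral_mult_right[symmetric] by (simp add: mult.commute)
  ultimately show ?thesis
    by (simp add: z_def set_integral_complex_of_real)
qed

section \<open>The right half-plane and the exponential type\<close>

text \<open>The integral formula for \<open>H_fun\<close> with complex argument and the principal
  power. It is considered for positive real part, where \<open>z\<close> and \<open>z^2\<close> both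
  avoid the cut.\<close>

definition H_right :: "real \<Rightarrow> complex \<Rightarrow> complex" where
  "H_right \<alpha> z = z powr of_real \<alpha>
     - of_real (2 / pi * sin (pi * \<alpha> / 2)) * (z * sin z * stieltjes (\<lambda>t. t powr \<alpha> / sinh t) (z\<^sup>2))"

lemma square_not_nonpos_Reals:
  assumes "Re z > 0"
  shows "z\<^sup>2 \<notin> \<real>\<^sub>\<le>\<^sub>0"
proof
  assume "z\<^sup>2 \<in> \<real>\<^sub>\<le>\<^sub>0"
  then have "Re (z\<^sup>2) \<le> 0" "Im (z\<^sup>2) = 0"
    unfolding complex_nonpos_Reals_iff by blast+
  then have "(Re z)\<^sup>2 - (Im z)\<^sup>2 \<le> 0" "Re z * Im z = 0"
    by (simp_all add: Re_power2 Im_power2)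
  moreover from this assms have "Im z = 0" by simp
  ultimately have "(Re z)\<^sup>2 \<le> 0" by simp
  with assms show False by simp
qed

lemma holomorphic_H_right:
  assumes "\<alpha> > 0"
  shows "H_right \<alpha> holomorphic_on {z. Re z > 0}"
proof -
  have "stieltjes (\<lambda>t. t powr \<alpha> / sinh t) holomorphic_on - \<real>\<^sub>\<le>\<^sub>0"
    unfolding holomorphic_on_def field_differentiable_def
    using stieltjes_has_field_derivative[OF set_integrable_powr_over_sinh[OF assms]]
    by (fastforce intro: has_field_derivative_at_within)
  then have "(stieltjes (\<lambda>t. t powr \<alpha> / sinh t) \<circ> (\<lambda>z. z\<^sup>2)) holomorphic_on {z. Re z > 0}"
    by (rule holomorphic_on_compose_gen[rotated]) (auto intro!: holomorphic_intros dest: square_not_nonpos_Reals)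
  then have *: "(\<lambda>z. stieltjes (\<lambda>t. t powr \<alpha> / sinh t) (z\<^sup>2)) holomorphic_on {z. Re z > 0}"
    by (simp add: o_def)
  have "z \<notin> \<real>\<^sub>\<le>\<^sub>0" if "Re z > 0" for z
    using that by (simp add: complex_nonpos_Reals_iff)
  then show ?thesis
    unfolding H_right_def[abs_def] by (intro holomorphic_intros *) auto
qed

lemma H_right_of_real:
  assumes "x > 0"
  shows "H_right \<alpha> (of_real x) = of_real (H_fun \<alpha> x)"
proof -
  have "H_int \<alpha> x = set_lebesgue_integral lborel {0<..} (\<lambda>t. x * sin x * (t powr \<alpha> / sinh t / (x\<^sup>2 + t\<^sup>2)))"
    using assms by (simp add: H_int_def mult_ac)
  also have "\<dots> = x * sin x * set_lebesgue_integral lborel {0<..} (\<lambda>t. t powr \<alpha> / sinh t / (x\<^sup>2 + t\<^sup>2))"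
    by (rule set_integral_mult_right)
  finally have "complex_of_real (H_int \<alpha> x) = of_real x * of_real (sin x) * of_real (set_lebesgue_integral lborel {0<..} (\<lambda>t. t powr \<alpha> / sinh t / (x\<^sup>2 + t\<^sup>2)))"
    by simp
  also have "complex_of_real (set_lebesgue_integral lborel {0<..} (\<lambda>t. t powr \<alpha> / sinh t / (x\<^sup>2 + t\<^sup>2)))
      = stieltjes (\<lambda>t. t powr \<alpha> / sinh t) ((of_real x)\<^sup>2)"
    unfolding stieltjes_def set_integral_complex_of_real[symmetric] by simp
  finally show ?thesis
    using assms powr_of_real[of x \<alpha>] by (simp add: H_right_def H_fun_def sin_of_real)
qed

context
  fixes \<alpha> :: real and N :: nat
  assumes \<alpha>N: "0 < \<alpha> - 2 * real N" "\<alpha> - 2 * real N < 2"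
begin

lemma \<alpha>_pos: "\<alpha> > 0"
  using \<alpha>N by linarith

lemma sin_half_pi_alpha_nonzero: "sin (pi * \<alpha> / 2) \<noteq> 0"
proof -
  have "sin (pi * (\<alpha> - 2 * real N) / 2) > 0" using \<alpha>N by (intro sin_gt_zero) auto
  moreover have "pi * (\<alpha> - 2 * real N) / 2 = pi * \<alpha> / 2 - real N * pi" by (simp add: field_simps)
  ultimately show ?thesis by (auto simp: sin_diff sin_npi)
qed

text \<open>Identity theorem on the right half-plane: both functions are holomorphic there and agree
  on \<open>(0, pi)\<close>.\<close>

lemma H_ext_eq_H_right:
  assumes "Re z > 0"
  shows "H_ext \<alpha> N z = H_right \<alpha> z"
proof -
  define S where "S = {z. Re z > 0}"
  define U where "U = complex_of_real ` {0<..<pi}"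
  have "H_ext \<alpha> N z - H_right \<alpha> z = 0"
  proof (rule analytic_continuation[where f = "\<lambda>z. H_ext \<alpha> N z - H_right \<alpha> z" and S = S and U = U and \<xi> = 1])
    show "(\<lambda>z. H_ext \<alpha> N z - H_right \<alpha> z) holomorphic_on S"
      unfolding S_def
      by (intro holomorphic_intros holomorphic_H_right \<alpha>_pos holomorphic_on_subset[OF holomorphic_H_ext[OF \<alpha>N]]) auto
    show "open S" unfolding S_def by (rule open_halfspace_Re_gt)
    show "connected S" unfolding S_def by (intro convex_connected convex_halfspace_Re_gt)
    show "U \<subseteq> S" by (auto simp: U_def S_def)
    show "1 \<in> S" by (simp add: S_def)
    \<comment> \<open>The points \<open>1 + 1 / (n + 1)\<close> are at most 2, hence below
      \<open>pi\<close>.\<close>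
    show "1 islimpt U"
      unfolding islimpt_sequential
    proof (intro exI[of _ "\<lambda>n. complex_of_real (1 + inverse (real (Suc n)))"] conjI allI)
      fix n
      have "inverse (real (Suc n)) \<le> 1" by (simp add: inverse_le_1_iff)
      moreover have "inverse (real (Suc n)) > 0" by simp
      ultimately have "1 + inverse (real (Suc n)) \<in> {0<..<pi}" "1 + inverse (real (Suc n)) \<noteq> 1"
        unfolding greaterThanLessThan_iff using pi_gt3 by linarith+
      then show "complex_of_real (1 + inverse (real (Suc n))) \<in> U - {1}"
        unfolding U_def by (metis Diff_iff image_eqI of_real_eq_1_iff singletonD)
    next
      show "(\<lambda>n. complex_of_real (1 + inverse (real (Suc n)))) \<longlonglongrightarrow> 1"
        using tendsto_of_real[OF LIMSEQ_inverse_real_of_nat_add[of 1]] by (simp only: of_real_1)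
    qed
    show "H_ext \<alpha> N u - H_right \<alpha> u = 0" if "u \<in> U" for u
      using that H_ext_eq_H_fun_near_0[OF \<alpha>N] H_right_of_real by (auto simp: U_def)
    show "z \<in> S" using assms by (simp add: S_def)
  qed
  then show ?thesis by simp
qed

lemma H_ext_eq_H_fun:
  assumes "x \<ge> 0"
  shows "H_ext \<alpha> N (of_real x) = of_real (H_fun \<alpha> x)"
proof (cases "x = 0")
  \<comment> \<open>Both sides are 0: \<open>0 powr \<alpha> = 0\<close>, and \<open>H_int\<close>
    is 0 at the origin by definition.\<close>
  case True
  then show ?thesis by (simp add: H_ext_def H_fun_def H_int_def)
next
  case False
  with assms show ?thesis by (simp add: H_ext_eq_H_right H_right_of_real)
qed

section \<open>Lower and upper bounds for the exponential type\<close>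

text \<open>Factoring \<open>exp x\<close> out of \<open>sinh x\<close> leaves the decay
  \<open>exp (- (\<kappa> * x))\<close> with \<open>\<kappa> = 1 - q > 0\<close>, which beats the
  linear factor.\<close>

lemma exp_over_sinh_Suc_tendsto_0:
  fixes q r :: real
  assumes "q < 1"
  shows "(\<lambda>n. real (Suc n) * r * exp (real (Suc n) * q) / sinh (real (Suc n))) \<longlonglongrightarrow> 0"
proof -
  define \<kappa> where "\<kappa> = 1 - q"
  have "\<kappa> > 0" using assms by (simp add: \<kappa>_def)
  then have "(\<lambda>n. 2 * r * (real (Suc n) * exp (- (\<kappa> * real (Suc n)))) / (1 - exp (- 2 * real (Suc n)))) \<longlonglongrightarrow> 0"
    by real_asymp
  moreover have "2 * r * (x * exp (- (\<kappa> * x))) / (1 - exp (- 2 * x)) = x * r * exp (x * q) / sinh x" if "x > 0" for x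
  proof -
    have eqs: "exp (x * q) = exp x * exp (- (\<kappa> * x))" "sinh x = exp x * (1 - exp (- 2 * x)) / 2"
      by (simp_all add: \<kappa>_def sinh_field_def algebra_simps flip: exp_add)
    show ?thesis unfolding eqs by simp
  qed
  ultimately show ?thesis by (simp del: of_nat_Suc)
qed

lemma powr_over_sinh_Suc_tendsto_0:
  fixes p r :: real
  assumes "r > 0"
  shows "(\<lambda>n. (real (Suc n) * r) powr p / sinh (real (Suc n))) \<longlonglongrightarrow> 0"
  using assms unfolding sinh_field_def by real_asymp

text \<open>Reverse triangle inequality for the two exponentials that make up the sine.\<close>

lemma sinh_Im_le_norm_sin: "sinh (Im z) \<le> norm (sin z)"
proof -
  have "norm (exp (- (\<i> * z))) - norm (exp (\<i> * z)) \<le> norm (exp (\<i> * z) - exp (- (\<i> * z)))"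
    using norm_triangle_ineq2[of "exp (- (\<i> * z))" "exp (\<i> * z)"] by (simp only: norm_minus_commute)
  then show ?thesis
    by (simp add: sin_exp_eq norm_divide norm_mult sinh_field_def)
qed

text \<open>Along the ray through \<open>\<delta> + \<i>\<close> the quotient \<open>z F(z) / sin z\<close> tends to a nonzero constant, which
  forces the type to be at least \<open>1 / \<bar>\<delta> + \<i>\<bar>\<close>. The imaginary axis itself is unavailable since the
  integral representation breaks down there.\<close>

lemma H_ext_type_lower_bound:
  assumes A: "A \<in> exp_type_bounds (H_ext \<alpha> N)"
  shows "1 \<le> A"
proof (rule ccontr)
  assume "\<not> 1 \<le> A"
  then have A1: "0 \<le> A" "A < 1" using A by (auto simp: exp_type_bounds_def)
  \<comment> \<open>The midpoint of \<open>A\<close> and 1: the growth rate that the definition of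
    the type yields for \<open>A\<close> with \<epsilon> equal to
    \<open>(1 - A) / 2\<close>.\<close>
  define B where "B = (1 + A) / 2"
  have B: "0 < B" "B < 1" using A1 by (auto simp: B_def)
  \<comment> \<open>This choice gives \<open>r * B \<le> (\<delta> + 1) * B = (2 - B) * B = 1 - (1 -
    B)^2 < 1\<close>, so that growth at rate \<open>B\<close> along the ray stays below that of the
    sine.\<close>
  define \<delta> where "\<delta> = 1 - B"
  have \<delta>: "\<delta> > 0" using B by (simp add: \<delta>_def)
  define w where "w = Complex \<delta> 1"
  define r where "r = norm w"
  define z where "z = (\<lambda>n. of_nat (Suc n) * w)"
  have r: "r > 0" by (simp add: r_def w_def complex_eq_iff)
  have q: "r * B < 1"
  proof -
    have "r \<le> \<delta> + 1" unfolding r_def using cmod_le[of w] \<delta> by (simp add: w_def)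
    then have "r * B \<le> (\<delta> + 1) * B" using B by (intro mult_right_mono) auto
    also have "\<dots> = 1 - (1 - B)\<^sup>2" by (simp add: \<delta>_def power2_eq_square algebra_simps)
    also have "\<dots> < 1" using B by simp
    finally show ?thesis .
  qed
  have norm_z: "norm (z n) = real (Suc n) * r" for n by (simp add: z_def norm_mult r_def del: of_nat_Suc)
  have z: "Re (z n) > 0" "Im (z n) = real (Suc n)" for n
    using \<delta> by (simp_all add: z_def w_def del: of_nat_Suc)
  have sinh: "sinh (real (Suc n)) > 0" for n by simp
  have sin_ge: "sinh (real (Suc n)) \<le> norm (sin (z n))" for n
    using sinh_Im_le_norm_sin[of "z n"] z(2) by simp
  have sin_nz: "sin (z n) \<noteq> 0" for n using sin_ge[of n] sinh[of n] by auto
  define c where "c = complex_of_real (2 / pi * sin (pi * \<alpha> / 2))"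
  have c: "c \<noteq> 0" using sin_half_pi_alpha_nonzero by (simp add: c_def)
  let ?g = "\<lambda>t. t powr \<alpha> / sinh t"
  obtain z0 :: complex where z0: "\<And>u. norm u \<ge> norm z0 \<Longrightarrow> norm (H_ext \<alpha> N u) \<le> exp (norm u * (A + (1 - A) / 2))"
    using A A1 unfolding exp_type_bounds_def by fastforce
  have AB: "A + (1 - A) / 2 = B" by (simp add: B_def field_simps)
  \<comment> \<open>Under the assumption the numerator grows at most like
    \<open>exp (r * B * Suc n)\<close> times a linear factor, whereas the sine is at least
    \<open>sinh (Suc n)\<close>.\<close>
  have lim1: "(\<lambda>n. z n * H_ext \<alpha> N (z n) / sin (z n)) \<longlonglongrightarrow> 0"
  proof (rule Lim_null_comparison[OF _ exp_over_sinh_Suc_tendsto_0[OF q, of r]])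
    obtain n0 :: nat where n0: "norm z0 / r \<le> real n0" using real_arch_simple by blast
    show "\<forall>\<^sub>F n in sequentially. norm (z n * H_ext \<alpha> N (z n) / sin (z n))
            \<le> real (Suc n) * r * exp (real (Suc n) * (r * B)) / sinh (real (Suc n))"
      using eventually_ge_at_top[of n0]
    proof eventually_elim
      case (elim n)
      have "norm z0 / r \<le> real (Suc n)" using n0 elim by simp
      then have "norm z0 \<le> norm (z n)" using r by (simp add: norm_z divide_le_eq)
      then have "norm (H_ext \<alpha> N (z n)) \<le> exp (real (Suc n) * (r * B))"
        using z0[of "z n"] unfolding AB norm_z by (simp only: mult.assoc)
      then show ?case
        unfolding norm_divide norm_mult norm_z using sin_ge[of n] sinh[of n] r
        by (intro frac_le mult_left_mono mult_nonneg_nonneg) auto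
    qed
  qed
  have lim2: "(\<lambda>n. z n * z n powr of_real \<alpha> / sin (z n)) \<longlonglongrightarrow> 0"
  proof (rule Lim_null_comparison[OF _ powr_over_sinh_Suc_tendsto_0[OF r, of "\<alpha> + 1"]])
    show "\<forall>\<^sub>F n in sequentially. norm (z n * z n powr of_real \<alpha> / sin (z n))
            \<le> (real (Suc n) * r) powr (\<alpha> + 1) / sinh (real (Suc n))"
    proof (intro always_eventually allI)
      fix n
      have "norm (z n * z n powr of_real \<alpha>) = (real (Suc n) * r) powr (\<alpha> + 1)"
        using r by (simp add: norm_mult norm_powr_real_powr' norm_z powr_add del: of_nat_Suc)
      then show "norm (z n * z n powr of_real \<alpha> / sin (z n)) \<le> (real (Suc n) * r) powr (\<alpha> + 1) / sinh (real (Suc n))"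
        unfolding norm_divide using sin_ge[of n] sinh[of n] by (intro frac_le) auto
    qed
  qed
  have "Im (w\<^sup>2) \<noteq> 0" using \<delta> by (simp add: w_def power2_eq_square)
  from stieltjes_tendsto_along_ray[OF set_integrable_powr_over_sinh[OF \<alpha>_pos] _ this]
  have lim3: "(\<lambda>n. (z n)\<^sup>2 * stieltjes ?g ((z n)\<^sup>2)) \<longlonglongrightarrow> of_real (C_const \<alpha>)"
    by (simp add: z_def power_mult_distrib C_const_def)
  \<comment> \<open>In the integral representation the power term is negligible against the sine and
    the Stieltjes term tends to \<open>C_const \<alpha>\<close>; the quotient would have both 0 and
    \<open>- c * C_const \<alpha>\<close> as its limit.\<close>
  have "z n * H_ext \<alpha> N (z n) / sin (z n) = z n * z n powr of_real \<alpha> / sin (z n) - c * ((z n)\<^sup>2 * stieltjes ?g ((z n)\<^sup>2))" for n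
    unfolding H_ext_eq_H_right[OF z(1)] H_right_def c_def[symmetric]
    using sin_nz[of n] by (simp add: right_diff_distrib diff_divide_distrib power2_eq_square)
  moreover have "(\<lambda>n. z n * z n powr of_real \<alpha> / sin (z n) - c * ((z n)\<^sup>2 * stieltjes ?g ((z n)\<^sup>2))) \<longlonglongrightarrow> 0 - c * of_real (C_const \<alpha>)"
    by (intro tendsto_diff tendsto_mult tendsto_const lim2 lim3)
  ultimately have "0 = 0 - c * of_real (C_const \<alpha>)"
    using lim1 LIMSEQ_unique by (simp only:) blast
  then show False using c C_const_pos[OF \<alpha>_pos] by simp
qed

text \<open>The polynomial factor in \<open>H_ext_growth\<close> is absorbed by
  \<open>exp (\<epsilon> * norm z)\<close> for large \<open>norm z\<close>.\<close>

lemma H_ext_type_upper_bound: "1 \<in> exp_type_bounds (H_ext \<alpha> N)"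
proof -
  obtain B where B: "B > 0" "\<And>z. norm (H_ext \<alpha> N z) \<le> B * (1 + norm z) ^ (2 * N + 3) * exp (norm z)"
    using H_ext_growth[OF \<alpha>N] by blast
  have "\<exists>z0::complex. \<forall>z. norm z \<ge> norm z0 \<longrightarrow> norm (H_ext \<alpha> N z) \<le> exp (norm z * (1 + \<epsilon>))" if \<epsilon>: "\<epsilon> > 0" for \<epsilon>
  proof -
    define m where "m = 2 * N + 3"
    have "((\<lambda>x. B * (1 + x) ^ m * exp (- (\<epsilon> * x))) \<longlongrightarrow> 0) at_top"
      using \<epsilon> by real_asymp
    then have "\<forall>\<^sub>F x in at_top. B * (1 + x) ^ m * exp (- (\<epsilon> * x)) < 1"
      by (rule order_tendstoD(2)) simp
    then obtain x0 where x0: "\<And>x. x \<ge> x0 \<Longrightarrow> B * (1 + x) ^ m * exp (- (\<epsilon> * x)) < 1"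
      unfolding eventually_at_top_linorder by blast
    \<comment> \<open>\<open>exp_type_bounds\<close> encodes the radius as the norm of a complex
      number, here \<open>\<bar>x0\<bar>\<close>, which is at least \<open>x0\<close>.\<close>
    have "norm (H_ext \<alpha> N z) \<le> exp (norm z * (1 + \<epsilon>))" if "norm z \<ge> norm (complex_of_real \<bar>x0\<bar>)" for z
    proof -
      have "B * (1 + norm z) ^ m * exp (- (\<epsilon> * norm z)) * exp (norm z * (1 + \<epsilon>)) \<le> 1 * exp (norm z * (1 + \<epsilon>))"
        using that by (intro mult_right_mono less_imp_le[OF x0]) auto
      moreover have "exp (- (\<epsilon> * norm z)) * exp (norm z * (1 + \<epsilon>)) = exp (norm z)"
        by (simp flip: exp_add add: algebra_simps)
      ultimately show ?thesis using B(2)[of z] by (simp add: m_def mult.assoc)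
    qed
    then show ?thesis by blast
  qed
  then show ?thesis by (auto simp: exp_type_bounds_def)
qed

lemma entire_of_exp_type_H_ext: "entire_of_exp_type (H_ext \<alpha> N) 1"
  unfolding entire_of_exp_type_def
  using holomorphic_H_ext[OF \<alpha>N] H_ext_type_upper_bound
    cInf_eq_minimum[OF H_ext_type_upper_bound H_ext_type_lower_bound] by auto

end

section \<open>Continuity at the poles and conclusion\<close>

text \<open>The poles are discrete: one in \<open>ball x 1\<close> has an index \<open>k\<close>
  with \<open>k \<le> k * pi \<le> \<bar>x\<bar> + 1\<close>, so only finitely many lie
  there.\<close>

lemma eventually_not_in_poles: "\<forall>\<^sub>F y in at x. y \<notin> poles"
proof -
  define m where "m = \<lceil>\<bar>x\<bar> + 1\<rceil>"
  have "poles \<inter> ball x 1 \<subseteq> (\<lambda>i. of_int i * pi) ` {-m..m}"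
  proof
    fix y assume y: "y \<in> poles \<inter> ball x 1"
    then obtain k :: nat where k: "y = real k * pi \<or> y = - (real k * pi)"
      unfolding poles_def by auto
    have "real k * 1 \<le> real k * pi" using pi_ge_two by (intro mult_left_mono) auto
    also have "real k * pi = \<bar>y\<bar>" using k by (auto simp: abs_mult)
    also have "\<bar>y\<bar> \<le> \<bar>x\<bar> + 1" using y by (auto simp: dist_real_def)
    finally have "int k \<le> m" unfolding m_def by linarith
    moreover have "y = of_int (int k) * pi \<or> y = of_int (- int k) * pi" using k by simp
    moreover have "- m \<le> int k" unfolding m_def by linarith
    ultimately show "y \<in> (\<lambda>i. of_int i * pi) ` {-m..m}"
      by (metis atLeastAtMost_iff image_eqI minus_le_iff neg_le_iff_le)
  qed
  then have "finite (poles \<inter> ball x 1)" by (rule finite_subset) simp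
  then have "\<forall>\<^sub>F y in at x. y \<notin> poles \<inter> ball x 1"
    using islimpt_finite islimpt_iff_eventually by blast
  moreover have "\<forall>\<^sub>F y in at x. y \<in> ball x 1"
    by (intro eventually_at_in_open') auto
  ultimately show ?thesis by eventually_elim auto
qed

text \<open>Near a pole \<open>R\<close> agrees with the continuous function \<open>H_ext\<close> on
  a punctured neighbourhood, so agreement off the poles already determines the limits.\<close>

lemma expands_on_reals_H_ext:
  assumes \<alpha>N: "0 < \<alpha> - 2 * real N" "\<alpha> - 2 * real N < 2"
    and R: "\<And>x. x \<notin> poles \<Longrightarrow> H_ext \<alpha> N (of_real x) = of_real (R x)"
  shows "expands_on_reals (H_ext \<alpha> N) R"
  unfolding expands_on_reals_def
proof (intro conjI allI impI ballI)
  fix x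
  have "isCont (H_ext \<alpha> N) (of_real x)"
    using holomorphic_on_imp_continuous_on[OF holomorphic_H_ext[OF \<alpha>N]] by (simp add: continuous_on_eq_continuous_at)
  then have "((\<lambda>y. H_ext \<alpha> N (of_real y)) \<longlongrightarrow> H_ext \<alpha> N (of_real x)) (at x)"
    by (intro isCont_tendsto_compose[where g = "H_ext \<alpha> N"] tendsto_intros) auto
  then show "((\<lambda>y. complex_of_real (R y)) \<longlongrightarrow> H_ext \<alpha> N (of_real x)) (at x)"
    by (rule Lim_transform_eventually) (use eventually_not_in_poles[of x] R in \<open>auto elim: eventually_mono\<close>)
qed (use R in auto)

theorem theorem3p3:
  fixes \<alpha> :: real and N :: nat
  assumes "\<alpha> > 0"
    and "\<not> (\<exists>m::int. even m \<and> \<alpha> = of_int m)"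
    and "N = nat \<lfloor>\<alpha> / 2\<rfloor>"
  shows "\<exists>F :: complex \<Rightarrow> complex.
     (\<forall>x\<ge>0. F (complex_of_real x) = complex_of_real (H_fun \<alpha> x)) \<and>
     entire_of_exp_type F 1 \<and>
     (\<forall>k::nat. F (complex_of_real (real k * pi)) = complex_of_real (\<bar>real k * pi\<bar> powr \<alpha>)) \<and>
     (\<forall>x. x \<notin> poles \<longrightarrow> summable (\<lambda>j. series_term (\<alpha> - 2 * real N) x (Suc j))) \<and>
     expands_on_reals F
       (\<lambda>x. sin x *
          (2 / pi * (\<Sum>n<N. sin (pi * (\<alpha> - 2 * real n - 2) / 2)
                               * C_const (\<alpha> - 2 * real n - 2) * x ^ (2 * n + 1))
           + 2 * x ^ (2 * N + 1) * pole_series (\<alpha> - 2 * real N) x)) \<and>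
     (\<alpha> < 2 \<longrightarrow>
        (\<forall>x. x \<notin> poles \<longrightarrow> summable (\<lambda>j. series_term \<alpha> x (Suc j))) \<and>
        expands_on_reals F (\<lambda>x. 2 * x * sin x * pole_series \<alpha> x))"
proof -
  \<comment> \<open>The floor gives \<open>0 \<le> \<alpha> - 2 * real N < 2\<close>; excluding even
    integers makes the lower bound strict.\<close>
  have N: "real N = of_int \<lfloor>\<alpha> / 2\<rfloor>" using assms(1,3) by simp
  have "\<alpha> \<noteq> of_int (2 * \<lfloor>\<alpha> / 2\<rfloor>)" using assms(2) dvd_triv_left by blast
  then have "\<alpha> \<noteq> 2 * real N" by (simp add: N)
  moreover have "real N \<le> \<alpha> / 2" "\<alpha> / 2 < real N + 1" unfolding N by linarith+
  ultimately have \<alpha>N: "0 < \<alpha> - 2 * real N" "\<alpha> - 2 * real N < 2" by linarith+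
  have on_reals: "H_ext \<alpha> N (of_real x) = of_real (H_fun \<alpha> x)" if "x \<ge> 0" for x
    by (rule H_ext_eq_H_fun[OF \<alpha>N that])
  \<comment> \<open>At nonzero multiples of \<open>pi\<close> the factor \<open>sin x\<close> in
    \<open>H_int\<close> vanishes; at 0 the definition gives 0 directly.\<close>
  have at_multiples: "H_ext \<alpha> N (complex_of_real (real k * pi)) = complex_of_real (\<bar>real k * pi\<bar> powr \<alpha>)" for k
    using on_reals[of "real k * pi"] by (simp add: H_fun_def H_int_def)
  \<comment> \<open>With \<open>N = 0\<close> the polynomial sum is empty, and the general series
    becomes the special one.\<close>
  have small: "N = 0" if "\<alpha> < 2"
  proof -
    have "real N < 1" using that \<alpha>N(1) by linarith
    then show ?thesis by simp
  qed
  show ?thesis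
  proof (intro exI[of _ "H_ext \<alpha> N"] conjI allI impI)
    show "expands_on_reals (H_ext \<alpha> N) (\<lambda>x. 2 * x * sin x * pole_series \<alpha> x)" if "\<alpha> < 2"
    proof (rule expands_on_reals_H_ext[OF \<alpha>N])
      fix x assume "x \<notin> poles"
      from H_ext_eq_series[OF \<alpha>N this] small[OF that]
      show "H_ext \<alpha> N (of_real x) = of_real (2 * x * sin x * pole_series \<alpha> x)"
        by (simp add: mult_ac)
    qed
    show "summable (\<lambda>j. series_term \<alpha> x (Suc j))" if "\<alpha> < 2" "x \<notin> poles" for x
      using summable_series_term[OF \<alpha>N that(2)] small[OF that(1)] by simp
  qed (intro on_reals entire_of_exp_type_H_ext \<alpha>N at_multiples summable_series_term expands_on_reals_H_ext
        H_ext_eq_series; assumption)+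
qed

end
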